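(* Let $f\colon \mathbb{R}^2 \to \mathbb{R}$ be a continuous function. Then $f$ is horizontally rigid if and only if there exist $a,b,d \in \mathbb{R}$ such that $f(x,y) = a + bx + dy$ for all $(x,y) \in \mathbb{R}^2$.
   Context: For a function $f\colon \mathbb{R}^n \to \mathbb{R}$, $\operatorname{graph}(f) = \{(\vec{x}, f(\vec{x})) : \vec{x} \in \mathbb{R}^n\} \subseteq \mathbb{R}^{n+1}$, and for $c \in (0,\infty)$, $f(c\,\cdot)$ denotes the function $\vec{x} \mapsto f(c\vec{x})$. A function $f\colon \mathbb{R}^n \to \mathbb{R}$ is called horizontally rigid if $\operatorname{graph}(f(c\,\cdot))$ is isometric to $\operatorname{graph}(f)$ for all $c \in (0,\infty)$, i.e. for every $c \in (0,\infty)$ there exists an isometry $\varphi$ of $\mathbb{R}^{n+1}$ (with the Euclidean metric) such that $\varphi(\operatorname{graph}(f)) = \operatorname{graph}(f(c\,\cdot))$. *)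

theory Defs
  imports "HOL-Analysis.Analysis"
begin

text \<open>
  The space $R^{n+1}$ is represented by the product type \<^typ>\<open>(real^'n) \<times> real\<close>, the first
  component being the base point and the second one the vertical coordinate.  The library's
  metric on products is \<open>dist (x, s) (y, t) = sqrt ((dist x y)\<^sup>2 + (dist s t)\<^sup>2)\<close>, so this is
  exactly the Euclidean metric on $R^{n+1}$.
\<close>

definition fun_graph :: "(real^'n \<Rightarrow> real) \<Rightarrow> ((real^'n) \<times> real) set" where
  "fun_graph f = {(x, f x) | x. x \<in> UNIV}"

definition isometry :: "('a::metric_space \<Rightarrow> 'a) \<Rightarrow> bool" where
  "isometry \<phi> \<longleftrightarrow> surj \<phi> \<and> (\<forall>p q. dist (\<phi> p) (\<phi> q) = dist p q)"

definition horizontally_rigid :: "(real^'n \<Rightarrow> real) \<Rightarrow> bool" where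
  "horizontally_rigid f \<longleftrightarrow>
    (\<forall>c::real. c > 0 \<longrightarrow>
      (\<exists>\<phi> :: (real^'n) \<times> real \<Rightarrow> (real^'n) \<times> real.
        isometry \<phi> \<and> \<phi> ` fun_graph f = fun_graph (\<lambda>x. f (c *\<^sub>R x))))"

end

theory Submission
  imports Defs
begin

text \<open>
  Let \<open>Q\<close> be the recession cone of the epigraph of \<open>f\<close>, a closed convex cone containing the upward but not the
  downward vertical direction. An isometry between the graphs of \<open>f\<close> and \<open>f (c \<cdot>)\<close> preserves or exchanges their sides,
  so its linear part yields an orthogonal map \<open>P c\<close> taking the horizontal dilation of \<open>Q\<close> by \<open>1 / c\<close> onto \<open>Q\<close>.

  If \<open>P c\<close> and \<open>P d\<close> send the vertical direction to the same vector for some \<open>d < c\<close>, comparing the two copies of the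
  graph gives a contraction of the plane under which the differences of \<open>f\<close> are preserved in absolute value; iterating
  it towards its fixed point shows that \<open>f\<close> is constant. If \<open>Q\<close> contains no line, such \<open>c\<close> and \<open>d\<close> exist by the
  pigeonhole principle: the vertical direction is extreme in every dilation of \<open>Q\<close> (let \<open>c \<rightarrow> 0\<close>), and \<open>Q\<close> has only
  finitely many candidates for its image, because letting \<open>c \<rightarrow> \<infinity>\<close> exhibits \<open>Q\<close> as the product of a ray and a planar cone.

  If \<open>Q\<close> contains a line, then \<open>f\<close> is the sum of a linear function with slope \<open>m\<close> in one direction and a function \<open>g\<close>
  of the orthogonal coordinate. The same pigeonhole argument in the plane orthogonal to the line yields infinitely many
  scales \<open>c\<close>, arbitrarily close to \<open>0\<close>, any two of which give a similarity of the real line with ratio \<open>d / c\<close> that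
  multiplies the differences of \<open>g\<close> by \<open>N d / N c\<close>, where \<open>N c = sqrt (1 + m\<^sup>2 c\<^sup>2)\<close>. For \<open>m = 0\<close> it is a contraction
  as before; for \<open>m \<noteq> 0\<close> two such similarities would force different growth exponents on a nonconstant \<open>g\<close>.
\<close>


section \<open>The recession cone of the epigraph\<close>

text \<open>This recession cone is phrased through growth rates from every base point. Quantifying
  over all base points makes it a convex cone without any convexity of \<open>f\<close>.\<close>

definition rec_cone :: "('a::real_normed_vector \<Rightarrow> real) \<Rightarrow> ('a \<times> real) set" where
  "rec_cone f = {(v, z). \<forall>x t. t \<ge> 0 \<longrightarrow> f (x + t *\<^sub>R v) \<le> f x + t * z}"

lemma rec_coneI:
  assumes "\<And>x t. t \<ge> 0 \<Longrightarrow> f (x + t *\<^sub>R v) \<le> f x + t * z"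
  shows "(v, z) \<in> rec_cone f"
  using assms by (auto simp: rec_cone_def)

lemma rec_coneD: "(v, z) \<in> rec_cone f \<Longrightarrow> t \<ge> 0 \<Longrightarrow> f (x + t *\<^sub>R v) \<le> f x + t * z"
  by (auto simp: rec_cone_def)

lemma rec_cone_scaleR:
  assumes "w \<in> rec_cone f" "c \<ge> 0"
  shows "c *\<^sub>R w \<in> rec_cone f"
proof -
  obtain v z where w: "w = (v, z)" by (cases w)
  have "(c *\<^sub>R v, c * z) \<in> rec_cone f"
  proof (rule rec_coneI)
    fix x and t :: real assume "t \<ge> 0"
    then show "f (x + t *\<^sub>R c *\<^sub>R v) \<le> f x + t * (c * z)"
      using rec_coneD[of v z f "t * c" x] assms w by (simp add: mult.assoc)
  qed
  then show ?thesis by (simp add: w)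
qed

lemma rec_cone_add:
  assumes "w \<in> rec_cone f" "w' \<in> rec_cone f"
  shows "w + w' \<in> rec_cone f"
proof -
  obtain v z v' z' where w: "w = (v, z)" "w' = (v', z')" by (cases w, cases w')
  have "(v + v', z + z') \<in> rec_cone f"
  proof (rule rec_coneI)
    fix x and t :: real assume t: "t \<ge> 0"
    have "f (x + t *\<^sub>R (v + v')) = f ((x + t *\<^sub>R v) + t *\<^sub>R v')"
      by (simp add: algebra_simps)
    also have "\<dots> \<le> f (x + t *\<^sub>R v) + t * z'"
      using assms(2) t unfolding w by (rule rec_coneD)
    also have "f (x + t *\<^sub>R v) \<le> f x + t * z"
      using assms(1) t unfolding w by (rule rec_coneD)
    finally show "f (x + t *\<^sub>R (v + v')) \<le> f x + t * (z + z')"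
      by (simp add: algebra_simps)
  qed
  then show ?thesis by (simp add: w)
qed

lemma rec_cone_vertical: "(0, z) \<in> rec_cone f \<longleftrightarrow> z \<ge> 0"
proof
  assume "(0, z) \<in> rec_cone f"
  from rec_coneD[OF this, of 1] show "z \<ge> 0" by simp
qed (auto simp: rec_cone_def)

lemma rec_cone_dilate:
  assumes "c > 0"
  shows "(v, z) \<in> rec_cone (\<lambda>x. f (c *\<^sub>R x)) \<longleftrightarrow> (c *\<^sub>R v, z) \<in> rec_cone f"
proof
  assume *: "(v, z) \<in> rec_cone (\<lambda>x. f (c *\<^sub>R x))"
  show "(c *\<^sub>R v, z) \<in> rec_cone f"
  proof (rule rec_coneI)
    fix x and t :: real assume "t \<ge> 0"
    then show "f (x + t *\<^sub>R c *\<^sub>R v) \<le> f x + t * z"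
      using rec_coneD[OF *, of t "x /\<^sub>R c"] assms by (simp add: algebra_simps)
  qed
next
  assume *: "(c *\<^sub>R v, z) \<in> rec_cone f"
  show "(v, z) \<in> rec_cone (\<lambda>x. f (c *\<^sub>R x))"
  proof (rule rec_coneI)
    fix x and t :: real assume "t \<ge> 0"
    then show "f (c *\<^sub>R (x + t *\<^sub>R v)) \<le> f (c *\<^sub>R x) + t * z"
      using rec_coneD[OF *, of t "c *\<^sub>R x"] by (simp add: algebra_simps)
  qed
qed

lemma closed_rec_cone:
  assumes "continuous_on UNIV f"
  shows "closed (rec_cone f)"
proof -
  have "rec_cone f = (\<Inter>x. \<Inter>t\<in>{0..}. {w. f (x + t *\<^sub>R fst w) \<le> f x + t * snd w})"
    by (auto simp: rec_cone_def)
  moreover have "closed {w. f (x + t *\<^sub>R fst w) \<le> f x + t * snd w}" for x t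
    by (intro closed_Collect_le continuous_intros continuous_on_compose2[OF assms]) auto
  ultimately show ?thesis by (auto intro!: closed_INT)
qed

text \<open>One bound is applied at the start of a segment and the other at its end. Together they
  pinch \<open>f\<close> to be affine along \<open>v\<close> with slope \<open>z\<close>.\<close>

lemma rec_cone_line:
  assumes "(v, z) \<in> rec_cone f" "(- v, - z) \<in> rec_cone f"
  shows "f (x + t *\<^sub>R v) = f x + t * z"
proof -
  have *: "f (y + s *\<^sub>R v) = f y + s * z" if "s \<ge> 0" for y s
    using rec_coneD[OF assms(1) that, of y] rec_coneD[OF assms(2) that, of "y + s *\<^sub>R v"] by simp
  show ?thesis
    using *[of t x] *[of "- t" "x + t *\<^sub>R v"] by (cases "t \<ge> 0") auto
qed

lemma rec_cone_lineI:
  assumes "\<And>x t. f (x + t *\<^sub>R v) = f x + t * z"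
  shows "(v, z) \<in> rec_cone f"
  by (rule rec_coneI) (simp add: assms)

section \<open>Sides of a graph and their recession directions\<close>

definition above_graph :: "('a \<Rightarrow> real) \<Rightarrow> ('a \<times> real) set" where
  "above_graph f = {p. f (fst p) < snd p}"

definition below_graph :: "('a \<Rightarrow> real) \<Rightarrow> ('a \<times> real) set" where
  "below_graph f = {p. snd p < f (fst p)}"

definition rec_dirs :: "'a::real_vector set \<Rightarrow> 'a set" where
  "rec_dirs A = {w. \<forall>p\<in>A. \<forall>t\<ge>0. p + t *\<^sub>R w \<in> A}"

text \<open>The strict side is one of the two open pieces of the complement of the graph, which is
  what an isometry of graphs can be tracked on. Strictness loses nothing, since the gap above the
  graph can be made arbitrarily small.\<close>

lemma rec_dirs_above: "rec_dirs (above_graph f) = rec_cone f"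
proof (intro set_eqI iffI)
  fix w assume w: "w \<in> rec_dirs (above_graph f)"
  obtain v z where vz: "w = (v, z)" by (cases w)
  have "(v, z) \<in> rec_cone f"
  proof (rule rec_coneI)
    fix x and t :: real assume t: "t \<ge> 0"
    show "f (x + t *\<^sub>R v) \<le> f x + t * z"
    proof (rule field_le_epsilon)
      fix e :: real assume "e > 0"
      then have "(x, f x + e) \<in> above_graph f" by (simp add: above_graph_def)
      then have "(x, f x + e) + t *\<^sub>R w \<in> above_graph f" using w t by (auto simp: rec_dirs_def)
      then show "f (x + t *\<^sub>R v) \<le> f x + t * z + e" by (simp add: above_graph_def vz)
    qed
  qed
  then show "w \<in> rec_cone f" by (simp add: vz)
next
  fix w assume w: "w \<in> rec_cone f"
  obtain v z where vz: "w = (v, z)" by (cases w)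
  have "f (x + t *\<^sub>R v) < s + t * z" if "f x < s" "t \<ge> 0" for s t x
    using rec_coneD[of v z f t x] w that by (simp add: vz)
  then show "w \<in> rec_dirs (above_graph f)"
    by (simp add: rec_dirs_def above_graph_def vz)
qed

text \<open>Read from the end point of a step, a bound on growth becomes a bound on descent, hence
  the change of sign.\<close>

lemma rec_dirs_below: "w \<in> rec_dirs (below_graph f) \<longleftrightarrow> - w \<in> rec_cone f"
proof
  assume w: "w \<in> rec_dirs (below_graph f)"
  obtain v z where vz: "w = (v, z)" by (cases w)
  have "(- v, - z) \<in> rec_cone f"
  proof (rule rec_coneI)
    fix x and t :: real assume t: "t \<ge> 0"
    show "f (x + t *\<^sub>R - v) \<le> f x + t * - z"
    proof (rule field_le_epsilon)
      fix e :: real assume "e > 0"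
      then have "(x + t *\<^sub>R - v, f (x + t *\<^sub>R - v) - e) \<in> below_graph f" by (simp add: below_graph_def)
      then have "(x + t *\<^sub>R - v, f (x + t *\<^sub>R - v) - e) + t *\<^sub>R w \<in> below_graph f"
        using w t unfolding rec_dirs_def by blast
      then show "f (x + t *\<^sub>R - v) \<le> f x + t * - z + e" by (simp add: below_graph_def vz)
    qed
  qed
  then show "- w \<in> rec_cone f" by (simp add: vz)
next
  assume w: "- w \<in> rec_cone f"
  obtain v z where vz: "w = (v, z)" by (cases w)
  have "s + t * z < f (x + t *\<^sub>R v)" if "s < f x" "t \<ge> 0" for s t x
    using rec_coneD[of "- v" "- z" f t "x + t *\<^sub>R v"] w that by (simp add: vz)
  then show "w \<in> rec_dirs (below_graph f)"
    by (simp add: rec_dirs_def below_graph_def vz)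
qed

lemma rec_dirs_affine_image:
  assumes "linear S" "inj S"
  shows "S w \<in> rec_dirs ((\<lambda>p. S p + b) ` A) \<longleftrightarrow> w \<in> rec_dirs A"
proof -
  have "(S p + b) + t *\<^sub>R S w = S (p + t *\<^sub>R w) + b" for p t
    using assms(1) by (simp add: linear_add linear_scale)
  moreover have "S q + b \<in> (\<lambda>p. S p + b) ` A \<longleftrightarrow> q \<in> A" for q
    using assms(2) by (auto dest: injD)
  ultimately have "(S p + b) + t *\<^sub>R S w \<in> (\<lambda>p. S p + b) ` A \<longleftrightarrow> p + t *\<^sub>R w \<in> A" for p t
    by metis
  then show ?thesis by (simp add: rec_dirs_def)
qed

text \<open>A vertical shear carries the open upper half space onto this side.\<close>

lemma connected_above:
  fixes f :: "'a::real_normed_vector \<Rightarrow> real"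
  assumes "continuous_on UNIV f"
  shows "connected (above_graph f)"
proof -
  have "above_graph f = (\<lambda>p. (fst p, f (fst p) + snd p)) ` (UNIV \<times> {0<..})"
  proof (intro set_eqI iffI)
    fix p assume "p \<in> above_graph f"
    then show "p \<in> (\<lambda>p. (fst p, f (fst p) + snd p)) ` (UNIV \<times> {0<..})"
      by (intro image_eqI[of _ _ "(fst p, snd p - f (fst p))"]) (auto simp: above_graph_def)
  qed (auto simp: above_graph_def)
  moreover have "connected ((\<lambda>p. (fst p, f (fst p) + snd p)) ` (UNIV \<times> {0<..}))"
    by (intro connected_continuous_image continuous_intros continuous_on_compose2[OF assms] connected_Times)
      auto
  ultimately show ?thesis by simp
qed

lemma connected_below:
  fixes f :: "'a::real_normed_vector \<Rightarrow> real"
  assumes "continuous_on UNIV f"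
  shows "connected (below_graph f)"
proof -
  have "below_graph f = (\<lambda>p. (fst p, - snd p)) ` above_graph (\<lambda>x. - f x)"
  proof (intro set_eqI iffI)
    fix p assume "p \<in> below_graph f"
    then show "p \<in> (\<lambda>p. (fst p, - snd p)) ` above_graph (\<lambda>x. - f x)"
      by (intro image_eqI[of _ _ "(fst p, - snd p)"]) (auto simp: above_graph_def below_graph_def)
  qed (auto simp: above_graph_def below_graph_def)
  moreover have "connected ((\<lambda>p. (fst p, - snd p)) ` above_graph (\<lambda>x. - f x))"
    by (intro connected_continuous_image connected_above continuous_intros assms)
  ultimately show ?thesis by simp
qed

lemma open_above:
  assumes "continuous_on UNIV f"
  shows "open (above_graph f)"
  unfolding above_graph_def
  by (intro open_Collect_less continuous_intros continuous_on_compose2[OF assms]) auto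

lemma open_below:
  assumes "continuous_on UNIV f"
  shows "open (below_graph f)"
  unfolding below_graph_def
  by (intro open_Collect_less continuous_intros continuous_on_compose2[OF assms]) auto

lemma Compl_fun_graph: "- fun_graph f = above_graph f \<union> below_graph f" "above_graph f \<inter> below_graph f = {}"
  by (auto simp: fun_graph_def above_graph_def below_graph_def)

lemma connected_subset_above_or_below:
  fixes f :: "real^'n \<Rightarrow> real"
  assumes "continuous_on UNIV f" "connected A" "A \<subseteq> above_graph f \<union> below_graph f"
  shows "A \<subseteq> above_graph f \<or> A \<subseteq> below_graph f"
proof -
  have "above_graph f \<inter> A = {} \<or> below_graph f \<inter> A = {}"
    using connectedD[OF assms(2) open_above[OF assms(1)] open_below[OF assms(1)] _ assms(3)]
      Compl_fun_graph(2)[of f] by (simp add: inf_assoc[symmetric])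
  then show ?thesis using assms(3) by blast
qed

section \<open>Isometries between graphs\<close>

lemma isometry_affine:
  fixes \<psi> :: "'a::euclidean_space \<Rightarrow> 'a"
  assumes "isometry \<psi>"
  obtains S b where "orthogonal_transformation S" "\<psi> = (\<lambda>p. S p + b)"
proof
  show "orthogonal_transformation (\<lambda>p. \<psi> p - \<psi> 0)"
    using assms by (simp add: orthogonal_transformation_isometry isometry_def dist_norm)
qed auto

text \<open>
  The isometry may exchange the two sides of the graphs; this sign is moved from \<open>P\<close> to \<open>e\<close>, so that
  \<open>P\<close> always respects the cones.
\<close>
lemma graph_isometry_rec_cone:
  fixes f g :: "real^'n \<Rightarrow> real"
  assumes f: "continuous_on UNIV f" and g: "continuous_on UNIV g"
    and \<psi>: "isometry \<psi>" and img: "\<psi> ` fun_graph g = fun_graph f"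
  obtains P e b where "orthogonal_transformation P" "\<bar>e\<bar> = (1::real)"
    "\<And>w. P w \<in> rec_cone f \<longleftrightarrow> w \<in> rec_cone g"
    "(\<lambda>p. e *\<^sub>R P p + b) ` fun_graph g = fun_graph f"
proof -
  obtain S b where S: "orthogonal_transformation S" and \<psi>_eq: "\<psi> = (\<lambda>p. S p + b)"
    using isometry_affine[OF \<psi>] .
  have lin: "linear S" and bijS: "bij S" and injS: "inj S"
    using S by (auto simp: orthogonal_transformation_linear orthogonal_transformation_bij
        orthogonal_transformation_inj)
  have bij: "bij \<psi>"
    using \<psi> unfolding isometry_def bij_def inj_def by (metis dist_eq_0_iff)
  have cont: "continuous_on A \<psi>" for A
    unfolding \<psi>_eq by (intro continuous_intros linear_continuous_on linear_conv_bounded_linear[THEN iffD1, OF lin])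
  have compl: "\<psi> ` above_graph g \<union> \<psi> ` below_graph g = above_graph f \<union> below_graph f"
    using bij_image_Compl_eq[OF bij, of "fun_graph g"] img
    by (simp add: Compl_fun_graph image_Un)
  have ne: "above_graph f \<noteq> {}" "below_graph f \<noteq> {}"
  proof -
    have "(0, f 0 + 1) \<in> above_graph f" "(0, f 0 - 1) \<in> below_graph f"
      by (auto simp: above_graph_def below_graph_def)
    then show "above_graph f \<noteq> {}" "below_graph f \<noteq> {}" by auto
  qed
  have "connected (\<psi> ` above_graph g)" "connected (\<psi> ` below_graph g)"
    using cont connected_above[OF g] connected_below[OF g] by (auto intro: connected_continuous_image)
  then have incl: "\<psi> ` above_graph g \<subseteq> above_graph f \<or> \<psi> ` above_graph g \<subseteq> below_graph f"
    "\<psi> ` below_graph g \<subseteq> above_graph f \<or> \<psi> ` below_graph g \<subseteq> below_graph f"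
    using connected_subset_above_or_below[OF f] compl by blast+
  \<comment> \<open>Each image lies within one side, and together they cover both nonempty sides, so
    neither can be a proper part of a side.\<close>
  have sets: "X = U \<or> X = L"
    if "X \<subseteq> U \<or> X \<subseteq> L" "Y \<subseteq> U \<or> Y \<subseteq> L" "X \<union> Y = U \<union> L" "U \<inter> L = {}" "U \<noteq> {}" "L \<noteq> {}"
    for X Y U L :: "((real^'n) \<times> real) set"
    using that by blast
  have "\<psi> ` above_graph g = above_graph f \<or> \<psi> ` above_graph g = below_graph f"
    by (rule sets[OF incl compl Compl_fun_graph(2) ne])
  then consider "\<psi> ` above_graph g = above_graph f" | "\<psi> ` above_graph g = below_graph f" by blast
  then show thesis
  proof cases
    case 1
    have "S w \<in> rec_cone f \<longleftrightarrow> w \<in> rec_cone g" for w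
      using rec_dirs_affine_image[OF lin injS, of w b "above_graph g"] 1
      by (simp add: \<psi>_eq rec_dirs_above)
    then show thesis using that[of S 1 b] S img \<psi>_eq by simp
  next
    case 2
    have "- S w \<in> rec_cone f \<longleftrightarrow> w \<in> rec_cone g" for w
      using rec_dirs_affine_image[OF lin injS, of w b "above_graph g"] 2
      by (simp add: \<psi>_eq rec_dirs_above rec_dirs_below)
    then show thesis using that[of "\<lambda>p. - S p" "-1" b] S img \<psi>_eq
      by (simp add: orthogonal_transformation_neg)
  qed
qed

section \<open>Extreme rays of planar cones\<close>

text \<open>This is extremality of the ray spanned by \<open>a\<close>, so distinct rays are later
  counted by their unit vectors.\<close>

definition extreme_in :: "'a::real_vector set \<Rightarrow> 'a \<Rightarrow> bool" where
  "extreme_in K a \<longleftrightarrow> a \<in> K \<and> (\<forall>x\<in>K. \<forall>y\<in>K. x + y = a \<longrightarrow> (\<exists>t. x = t *\<^sub>R a))"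

text \<open>A summand with a positive coefficient is a multiple of \<open>a\<close> by extremality.
  The norms then leave only the unit vectors \<open>a\<close> and \<open>- a\<close> for it, and
  pointedness rules out \<open>- a\<close>.\<close>

lemma extreme_in_cone_combination:
  fixes K :: "'a::real_normed_vector set"
  assumes cone: "\<And>x t. x \<in> K \<Longrightarrow> 0 \<le> t \<Longrightarrow> t *\<^sub>R x \<in> K"
    and pointed: "\<And>x. x \<in> K \<Longrightarrow> - x \<in> K \<Longrightarrow> x = 0"
    and a: "extreme_in K a" "norm a = 1" and b: "b \<in> K" "norm b = 1" and c: "c \<in> K" "norm c = 1"
    and comb: "a = s *\<^sub>R b + t *\<^sub>R c" and st: "0 \<le> s" "0 \<le> t"
  shows "a = b \<or> a = c"
proof -
  have *: "a = b'" if "0 < s'" "0 \<le> t'" "a = s' *\<^sub>R b' + t' *\<^sub>R c'"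
      "b' \<in> K" "norm b' = 1" "c' \<in> K" for b' c' s' t'
  proof -
    have "s' *\<^sub>R b' \<in> K" "t' *\<^sub>R c' \<in> K" "s' *\<^sub>R b' + t' *\<^sub>R c' = a"
      using cone that by auto
    then have "\<exists>r. s' *\<^sub>R b' = r *\<^sub>R a" using a(1) unfolding extreme_in_def by blast
    then obtain r where r: "s' *\<^sub>R b' = r *\<^sub>R a" ..
    then have "(1 / s') *\<^sub>R s' *\<^sub>R b' = (1 / s') *\<^sub>R r *\<^sub>R a" by (rule arg_cong)
    then have b': "b' = (r / s') *\<^sub>R a" using \<open>0 < s'\<close> by simp
    have "\<bar>r / s'\<bar> = 1"
      using arg_cong[OF b', of norm] a(2) \<open>norm b' = 1\<close> by auto
    then consider "r / s' = 1" | "r / s' = -1" by linarith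
    then show ?thesis
    proof cases
      case 2
      then have "- b' = a" using b' by simp
      then have "- b' \<in> K" using a(1) by (simp add: extreme_in_def)
      then show ?thesis using pointed[of b'] that by auto
    qed (use b' in simp)
  qed
  show ?thesis
  proof (cases "s = 0")
    case True
    then have "t \<noteq> 0" using comb a(2) by auto
    then show ?thesis using *[of t s c b] comb st b c by (auto simp: add.commute)
  next
    case False
    then show ?thesis using *[of s t b c] comb st b c by auto
  qed
qed

text \<open>There are at most two such vectors. Three of them in a plane are linearly dependent, and
  the signs of the coefficients in a relation contradict either extremality or pointedness.\<close>

lemma finite_extreme_in_plane:
  fixes K :: "'a::euclidean_space set"
  assumes dim: "DIM('a) = 3" and u: "u \<noteq> 0" "\<And>x. x \<in> K \<Longrightarrow> u \<bullet> x = 0"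
    and cone: "\<And>x t. x \<in> K \<Longrightarrow> 0 \<le> t \<Longrightarrow> t *\<^sub>R x \<in> K"
    and add: "\<And>x y. x \<in> K \<Longrightarrow> y \<in> K \<Longrightarrow> x + y \<in> K"
    and pointed: "\<And>x. x \<in> K \<Longrightarrow> - x \<in> K \<Longrightarrow> x = 0"
  shows "finite {a. extreme_in K a \<and> norm a = 1}" (is "finite ?X")
proof (rule ccontr)
  assume "infinite ?X"
  then obtain B where B: "B \<subseteq> ?X" "finite B" "card B = 3"
    using infinite_arbitrarily_large by blast
  then obtain a b c where abc: "B = {a, b, c}" "a \<noteq> b" "a \<noteq> c" "b \<noteq> c"
    by (auto simp: card_3_iff)
  have X: "extreme_in K a" "extreme_in K b" "extreme_in K c" "norm a = 1" "norm b = 1" "norm c = 1"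
    using B(1) abc(1) by auto
  then have K: "a \<in> K" "b \<in> K" "c \<in> K" by (auto simp: extreme_in_def)
  have "B \<subseteq> {x. u \<bullet> x = 0}" using abc K u(2) by auto
  then have "dependent B"
    using independent_card_le_dim[of B "{x. u \<bullet> x = 0}"] dim_hyperplane[OF u(1)] dim B(3) by auto
  then obtain h where h: "\<exists>v\<in>B. h v \<noteq> 0" "(\<Sum>v\<in>B. h v *\<^sub>R v) = 0"
    using dependent_finite[OF B(2)] by auto
  have sum0: "h a *\<^sub>R a + h b *\<^sub>R b + h c *\<^sub>R c = 0" using h(2) abc by (simp add: add.assoc)
  \<comment> \<open>One positive coefficient against two nonpositive ones makes \<open>x\<close> a
    nonnegative combination of \<open>y\<close> and \<open>z\<close>.\<close>
  have no: False
    if "\<alpha> *\<^sub>R x + \<beta> *\<^sub>R y + \<gamma> *\<^sub>R z = 0" "\<alpha> > 0" "\<beta> \<le> 0" "\<gamma> \<le> 0" "{x, y, z} = B" "x \<noteq> y" "x \<noteq> z"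
    for \<alpha> \<beta> \<gamma> x y z
  proof -
    have comb: "x = (- \<beta> / \<alpha>) *\<^sub>R y + (- \<gamma> / \<alpha>) *\<^sub>R z"
    proof -
      have "\<alpha> *\<^sub>R x = (- \<beta>) *\<^sub>R y + (- \<gamma>) *\<^sub>R z"
        using that(1) by (simp add: algebra_simps eq_neg_iff_add_eq_0)
      then have "(1 / \<alpha>) *\<^sub>R \<alpha> *\<^sub>R x = (1 / \<alpha>) *\<^sub>R ((- \<beta>) *\<^sub>R y + (- \<gamma>) *\<^sub>R z)"
        by (rule arg_cong)
      then show ?thesis using that(2) by (simp add: scaleR_right_distrib scaleR_right_diff_distrib)
    qed
    have "x \<in> ?X" "y \<in> ?X" "z \<in> ?X" using that(5) B(1) by auto
    then have xyz: "extreme_in K x" "norm x = 1" "y \<in> K" "norm y = 1" "z \<in> K" "norm z = 1"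
      by (auto simp: extreme_in_def)
    have "0 \<le> - \<beta> / \<alpha>" "0 \<le> - \<gamma> / \<alpha>" using that by (auto simp: divide_nonpos_pos)
    then have "x = y \<or> x = z"
      using extreme_in_cone_combination[OF _ _ xyz comb] cone pointed by blast
    then show False using that by auto
  qed
  \<comment> \<open>With all coefficients nonnegative, the relation puts a negative multiple of
    \<open>x\<close> into \<open>K\<close>.\<close>
  have no': False
    if "\<alpha> *\<^sub>R x + \<beta> *\<^sub>R y + \<gamma> *\<^sub>R z = 0" "\<alpha> > 0" "\<beta> \<ge> 0" "\<gamma> \<ge> 0" "{x, y, z} = B" for \<alpha> \<beta> \<gamma> x y z
  proof -
    have xyz: "x \<in> K" "y \<in> K" "z \<in> K" "norm x = 1" using that(5) K X abc by auto
    have "- (\<alpha> *\<^sub>R x) = \<beta> *\<^sub>R y + \<gamma> *\<^sub>R z"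
      using that(1) by (simp add: add.assoc eq_neg_iff_add_eq_0 neg_eq_iff_add_eq_0)
    then have "- (\<alpha> *\<^sub>R x) \<in> K" using add cone xyz that by auto
    then have "\<alpha> *\<^sub>R x = 0" using pointed cone[OF xyz(1), of \<alpha>] that(2) by fastforce
    then show False using that xyz by auto
  qed
  have pos: False
    if eq: "\<alpha> *\<^sub>R x + \<beta> *\<^sub>R y + \<gamma> *\<^sub>R z = 0" and "\<alpha> > 0" and xyz: "{x, y, z} = B" "x \<noteq> y" "x \<noteq> z" "y \<noteq> z"
    for \<alpha> \<beta> \<gamma> x y z
  proof -
    \<comment> \<open>For mixed signs the relation is negated and the vector with the single
      negative coefficient comes first, which is the situation of \<open>no\<close>.\<close>
    have "(- \<gamma>) *\<^sub>R z + (- \<alpha>) *\<^sub>R x + (- \<beta>) *\<^sub>R y = - (\<alpha> *\<^sub>R x + \<beta> *\<^sub>R y + \<gamma> *\<^sub>R z)"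
      "(- \<beta>) *\<^sub>R y + (- \<alpha>) *\<^sub>R x + (- \<gamma>) *\<^sub>R z = - (\<alpha> *\<^sub>R x + \<beta> *\<^sub>R y + \<gamma> *\<^sub>R z)"
      by (simp_all add: algebra_simps)
    then have neg: "(- \<gamma>) *\<^sub>R z + (- \<alpha>) *\<^sub>R x + (- \<beta>) *\<^sub>R y = 0"
      "(- \<beta>) *\<^sub>R y + (- \<alpha>) *\<^sub>R x + (- \<gamma>) *\<^sub>R z = 0"
      using eq by auto
    have sets: "{z, x, y} = B" "{y, x, z} = B" using xyz(1) by auto
    consider "\<beta> \<le> 0" "\<gamma> \<le> 0" | "\<beta> \<ge> 0" "\<gamma> \<ge> 0" | "\<beta> \<ge> 0" "\<gamma> < 0" | "\<beta> < 0" "\<gamma> \<ge> 0" by linarith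
    then show False
    proof cases
      case 1 then show False using no[OF eq] that by blast
    next
      case 2 then show False using no'[OF eq] that by blast
    next
      case 3 then show False using no[OF neg(1) _ _ _ sets(1)] that by auto
    next
      case 4 then show False using no[OF neg(2) _ _ _ sets(2)] that by auto
    qed
  qed
  have nonzero: False
    if eq: "\<alpha> *\<^sub>R x + \<beta> *\<^sub>R y + \<gamma> *\<^sub>R z = 0" and "\<alpha> \<noteq> 0" and xyz: "{x, y, z} = B" "x \<noteq> y" "x \<noteq> z" "y \<noteq> z"
    for \<alpha> \<beta> \<gamma> x y z
  proof (cases "\<alpha> > 0")
    case True then show False using pos[OF eq] xyz by blast
  next
    case False
    have "(- \<alpha>) *\<^sub>R x + (- \<beta>) *\<^sub>R y + (- \<gamma>) *\<^sub>R z = - (\<alpha> *\<^sub>R x + \<beta> *\<^sub>R y + \<gamma> *\<^sub>R z)"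
      by (simp add: algebra_simps)
    then have "(- \<alpha>) *\<^sub>R x + (- \<beta>) *\<^sub>R y + (- \<gamma>) *\<^sub>R z = 0" using eq by simp
    from pos[OF this _ xyz] show False using False that(2) by auto
  qed
  consider "h a \<noteq> 0" | "h b \<noteq> 0" | "h c \<noteq> 0" using h(1) abc by auto
  then show False
  proof cases
    case 1 then show False using nonzero[OF sum0] abc by auto
  next
    case 2
    have "h b *\<^sub>R b + h a *\<^sub>R a + h c *\<^sub>R c = 0" using sum0 by (simp add: add_ac)
    from nonzero[OF this 2] show False using abc by auto
  next
    case 3
    have "h c *\<^sub>R c + h a *\<^sub>R a + h b *\<^sub>R b = 0" using sum0 by (simp add: add_ac)
    from nonzero[OF this 3] show False using abc by auto
  qed
qed

section \<open>Functions invariant under similarities\<close>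

lemma dist_funpow:
  fixes T :: "'a::metric_space \<Rightarrow> 'a"
  assumes "\<And>x y. dist (T x) (T y) = c * dist x y"
  shows "dist ((T ^^ n) x) ((T ^^ n) y) = c ^ n * dist x y"
  by (induction n) (simp_all add: assms)

lemma diff_funpow:
  fixes g :: "'a \<Rightarrow> real"
  assumes "\<And>x y. \<bar>g (T x) - g (T y)\<bar> = s * \<bar>g x - g y\<bar>"
  shows "\<bar>g ((T ^^ n) x) - g ((T ^^ n) y)\<bar> = s ^ n * \<bar>g x - g y\<bar>"
  by (induction n) (simp_all add: assms)

text \<open>The difference of values between \<open>x\<close> and the fixed point keeps its absolute
  value under iteration, while the iterates of \<open>x\<close> converge to the fixed point.\<close>

lemma constant_if_contraction_invariant:
  fixes f :: "'a::{complete_space} \<Rightarrow> real"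
  assumes f: "continuous_on UNIV f" and c: "0 \<le> c" "c < 1"
    and T: "\<And>x y. dist (T x) (T y) = c * dist x y"
    and fT: "\<And>x y. \<bar>f (T x) - f (T y)\<bar> = \<bar>f x - f y\<bar>"
  shows "f x = f y"
proof -
  obtain p where p: "T p = p"
    using banach_fix_type[OF c] T by (metis order_refl)
  have pn: "(T ^^ n) p = p" for n by (induction n) (simp_all add: p)
  have "f x = f p" for x
  proof -
    have "(\<lambda>n. c ^ n * dist x p) \<longlonglongrightarrow> 0 * dist x p"
      by (intro tendsto_intros LIMSEQ_realpow_zero c)
    then have "(\<lambda>n. dist ((T ^^ n) x) p) \<longlonglongrightarrow> 0"
      using dist_funpow[OF T, of _ x p] by (simp add: pn)
    then have "(\<lambda>n. (T ^^ n) x) \<longlonglongrightarrow> p" by (subst tendsto_dist_iff)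
    then have "(\<lambda>n. f ((T ^^ n) x)) \<longlonglongrightarrow> f p"
      using f by (auto simp: continuous_on_eq_continuous_at intro: isCont_tendsto_compose)
    then have "(\<lambda>n. \<bar>f ((T ^^ n) x) - f p\<bar>) \<longlonglongrightarrow> \<bar>f p - f p\<bar>" by (intro tendsto_intros)
    moreover have "\<bar>f ((T ^^ n) x) - f p\<bar> = \<bar>f x - f p\<bar>" for n
      using diff_funpow[of f T 1 n x p] fT pn by simp
    ultimately show ?thesis by (simp add: LIMSEQ_const_iff)
  qed
  then show ?thesis by metis
qed

text \<open>
  After \<open>n\<close> applications of \<open>A\<close> and then \<open>n\<close> of \<open>B\<close> the points stay bounded, whereas the difference
  of the values is multiplied by \<open>(\<sigma>\<tau>)\<^sup>n\<close>.
\<close>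
lemma constant_if_expansion_contraction:
  fixes g :: "'a::{heine_borel} \<Rightarrow> real"
  assumes g: "continuous_on UNIV g"
    and A: "\<And>x y. dist (A x) (A y) = a * dist x y" "a > 1"
      "\<And>x y. \<bar>g (A x) - g (A y)\<bar> = \<sigma> * \<bar>g x - g y\<bar>"
    and B: "\<And>x y. dist (B x) (B y) = b * dist x y" "0 < b" "a * b \<le> 1"
      "\<And>x y. \<bar>g (B x) - g (B y)\<bar> = \<tau> * \<bar>g x - g y\<bar>"
    and \<sigma>\<tau>: "\<sigma> * \<tau> > 1"
  shows "g x = g y"
proof (rule ccontr)
  assume ne: "g x \<noteq> g y"
  have "b < 1" using A(2) B(2,3) by (smt (verit) mult_less_cancel_right1)
  obtain p where p: "B p = p"
    using banach_fix_type[of b B] B \<open>b < 1\<close> by (metis less_imp_le order_refl)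
  have pn: "(B ^^ n) p = p" for n by (induction n) (simp_all add: p)
  define u where "u n z = (B ^^ n) ((A ^^ n) z)" for n z
  \<comment> \<open>The displacements of successive iterates of \<open>A\<close> form a geometric
    series with ratio \<open>a\<close>.\<close>
  have growth: "dist ((A ^^ n) z) z \<le> (a ^ n - 1) / (a - 1) * dist (A z) z" for n z
  proof (induction n)
    case (Suc n)
    have "dist ((A ^^ Suc n) z) z \<le> dist ((A ^^ n) (A z)) ((A ^^ n) z) + dist ((A ^^ n) z) z"
      by (simp add: funpow_swap1 dist_triangle)
    also have "\<dots> \<le> a ^ n * dist (A z) z + (a ^ n - 1) / (a - 1) * dist (A z) z"
      using Suc dist_funpow[OF A(1)] by simp
    also have "\<dots> = (a ^ Suc n - 1) / (a - 1) * dist (A z) z"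
      using A(2) by (simp add: field_simps)
    finally show ?case .
  qed simp
  \<comment> \<open>Contracting \<open>n\<close> times about \<open>p\<close> absorbs the factor
    \<open>a ^ n\<close> because \<open>a * b \<le> 1\<close>, so the bound does not depend on
    \<open>n\<close>.\<close>
  have bound: "dist p (u n z) \<le> dist (A z) z / (a - 1) + dist p z" for n z
  proof -
    have "dist p (u n z) = b ^ n * dist p ((A ^^ n) z)"
      using dist_funpow[OF B(1), of n p "(A ^^ n) z"] by (simp add: u_def pn)
    also have "dist p ((A ^^ n) z) \<le> (a ^ n - 1) / (a - 1) * dist (A z) z + dist p z"
      using growth[of n z] dist_triangle[of p "(A ^^ n) z" z] by (simp add: dist_commute)
    also have "(a ^ n - 1) / (a - 1) * dist (A z) z \<le> a ^ n * (dist (A z) z / (a - 1))"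
      using A(2) by (simp add: divide_right_mono mult_right_mono)
    also have "dist p z \<le> a ^ n * dist p z"
      using A(2) by (simp add: mult_le_cancel_right1)
    finally have "dist p (u n z) \<le> b ^ n * (a ^ n * (dist (A z) z / (a - 1)) + a ^ n * dist p z)"
      using B(2) by simp
    also have "\<dots> = (a * b) ^ n * (dist (A z) z / (a - 1) + dist p z)"
      by (simp add: power_mult_distrib algebra_simps)
    also have "\<dots> \<le> 1 * (dist (A z) z / (a - 1) + dist p z)"
      using A(2) B(2,3) by (intro mult_right_mono power_le_one) auto
    finally show ?thesis by simp
  qed
  define C where "C = max (dist (A x) x / (a - 1) + dist p x) (dist (A y) y / (a - 1) + dist p y)"
  have "compact (g ` cball p C)"
    using g by (intro compact_continuous_image compact_cball) (auto intro: continuous_on_subset)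
  then obtain M where M: "\<And>z. z \<in> cball p C \<Longrightarrow> \<bar>g z\<bar> \<le> M"
    using compact_imp_bounded bounded_iff by (metis image_eqI real_norm_def)
  have "(\<sigma> * \<tau>) ^ n * \<bar>g x - g y\<bar> \<le> 2 * M" for n
  proof -
    have "(\<sigma> * \<tau>) ^ n * \<bar>g x - g y\<bar> = \<bar>g (u n x) - g (u n y)\<bar>"
      using diff_funpow[of g B, OF B(4), of n] diff_funpow[of g A, OF A(3), of n]
      by (simp add: u_def power_mult_distrib)
    moreover have "u n x \<in> cball p C" "u n y \<in> cball p C"
      using bound[of n x] bound[of n y] by (auto simp: C_def)
    ultimately show ?thesis using M[of "u n x"] M[of "u n y"] by linarith
  qed
  moreover obtain n where "2 * M / \<bar>g x - g y\<bar> < (\<sigma> * \<tau>) ^ n"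
    using real_arch_pow[OF \<sigma>\<tau>] by blast
  ultimately show False using ne by (auto simp: divide_less_eq not_less[symmetric])
qed

section \<open>Pointed recession cones\<close>

lemma bounded_sequence_subseq:
  fixes g :: "nat \<Rightarrow> 'a::heine_borel"
  assumes "\<And>k. g k \<in> cball a B"
  obtains s l where "strict_mono s" "(\<lambda>k. g (s k)) \<longlonglongrightarrow> l"
proof -
  have "compact (cball a B)" by (rule compact_cball)
  then have "\<exists>l\<in>cball a B. \<exists>s. strict_mono s \<and> (g \<circ> s) \<longlonglongrightarrow> l"
    using assms unfolding compact_def by blast
  then show thesis using that unfolding comp_def by blast
qed

text \<open>\<open>P c\<close> is the linear part, up to the sign \<open>e\<close>, of an isometry
  from the graph of \<open>f (c \<cdot>)\<close> to that of \<open>f\<close>. The cone of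
  \<open>f (c \<cdot>)\<close> is written as a dilation, so that all scales are compared inside the
  single cone of \<open>f\<close>.\<close>

locale rigid_frame =
  fixes f :: "real^2 \<Rightarrow> real" and P :: "real \<Rightarrow> (real^2) \<times> real \<Rightarrow> (real^2) \<times> real"
  assumes cont: "continuous_on UNIV f"
    and orth: "c > 0 \<Longrightarrow> orthogonal_transformation (P c)"
    and cone: "c > 0 \<Longrightarrow> P c (v, z) \<in> rec_cone f \<longleftrightarrow> (c *\<^sub>R v, z) \<in> rec_cone f"
    and graph: "c > 0 \<Longrightarrow> \<exists>e b. \<bar>e\<bar> = (1::real) \<and> range (\<lambda>x. e *\<^sub>R P c (x, f (c *\<^sub>R x)) + b) = fun_graph f"
begin

abbreviation "Q \<equiv> rec_cone f"

lemma lin: "c > 0 \<Longrightarrow> linear (P c)"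
  using orth orthogonal_transformation_linear by blast

lemma inner_P: "c > 0 \<Longrightarrow> P c x \<bullet> P c y = x \<bullet> y"
  using orth orthogonal_transformation_def by blast

lemma norm_P: "c > 0 \<Longrightarrow> norm (P c x) = norm x"
  using orth orthogonal_transformation_norm by blast

lemma P_surj: "c > 0 \<Longrightarrow> \<exists>x. y = P c x"
  using orth orthogonal_transformation_surj surj_def by metis

lemma closed_Q: "closed Q"
  using cont by (rule closed_rec_cone)

lemma Q_limit: "(\<And>k. g k \<in> Q) \<Longrightarrow> g \<longlonglongrightarrow> l \<Longrightarrow> l \<in> Q"
  using closed_Q closed_sequentially by blast

text \<open>\<open>U x\<close> is the base point at scale \<open>d\<close> whose graph point lands
  on the same point of the graph of \<open>f\<close> as that of \<open>x\<close> at scale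
  \<open>c\<close>. Taking differences removes the translations, and \<open>s\<close> is the product
  of the two signs.\<close>

lemma graph_partner:
  assumes c: "c > 0" and d: "d > 0"
  obtains U where "\<And>x y. \<exists>s. \<bar>s\<bar> = (1::real) \<and>
    P d (U x - U y, f (d *\<^sub>R U x) - f (d *\<^sub>R U y)) = s *\<^sub>R P c (x - y, f (c *\<^sub>R x) - f (c *\<^sub>R y))"
proof -
  obtain e b where e: "\<bar>e\<bar> = (1::real)" and eb: "range (\<lambda>x. e *\<^sub>R P c (x, f (c *\<^sub>R x)) + b) = fun_graph f"
    using graph[OF c] by blast
  obtain e' b' where e': "\<bar>e'\<bar> = (1::real)" and eb': "range (\<lambda>x. e' *\<^sub>R P d (x, f (d *\<^sub>R x)) + b') = fun_graph f"
    using graph[OF d] by blast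
  have "\<exists>y. e *\<^sub>R P c (x, f (c *\<^sub>R x)) + b = e' *\<^sub>R P d (y, f (d *\<^sub>R y)) + b'" for x
  proof -
    have "e *\<^sub>R P c (x, f (c *\<^sub>R x)) + b \<in> range (\<lambda>x. e' *\<^sub>R P d (x, f (d *\<^sub>R x)) + b')"
      unfolding eb' using eb by blast
    then show ?thesis by auto
  qed
  then obtain U where U: "\<And>x. e *\<^sub>R P c (x, f (c *\<^sub>R x)) + b = e' *\<^sub>R P d (U x, f (d *\<^sub>R U x)) + b'"
    by metis
  have U': "e' *\<^sub>R P d (U x, f (d *\<^sub>R U x)) = e *\<^sub>R P c (x, f (c *\<^sub>R x)) + (b - b')" for x
    using U[of x] by (simp add: algebra_simps)
  have e'2: "e' * e' = 1" using e' abs_mult_self_eq[of e'] by simp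
  have "P d (U x - U y, f (d *\<^sub>R U x) - f (d *\<^sub>R U y)) = (e' * e) *\<^sub>R P c (x - y, f (c *\<^sub>R x) - f (c *\<^sub>R y))" for x y
  proof -
    have "e' *\<^sub>R (P d (U x, f (d *\<^sub>R U x)) - P d (U y, f (d *\<^sub>R U y)))
      = e *\<^sub>R (P c (x, f (c *\<^sub>R x)) - P c (y, f (c *\<^sub>R y)))"
      using U' by (simp add: scaleR_diff_right)
    then have "e' *\<^sub>R P d (U x - U y, f (d *\<^sub>R U x) - f (d *\<^sub>R U y)) = e *\<^sub>R P c (x - y, f (c *\<^sub>R x) - f (c *\<^sub>R y))"
      by (simp add: linear_diff[OF lin[OF c], symmetric] linear_diff[OF lin[OF d], symmetric])
    then have "e' *\<^sub>R e' *\<^sub>R P d (U x - U y, f (d *\<^sub>R U x) - f (d *\<^sub>R U y)) = e' *\<^sub>R e *\<^sub>R P c (x - y, f (c *\<^sub>R x) - f (c *\<^sub>R y))"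
      by simp
    then show ?thesis by (simp add: e'2)
  qed
  moreover have "\<bar>e' * e\<bar> = 1" using e e' by (simp add: abs_mult)
  ultimately show thesis using that[of U] by blast
qed

text \<open>Inner products with the common image of the vertical show that corresponding height
  differences agree up to sign. Equality of norms then makes \<open>U\<close> an isometry of the
  plane.\<close>

lemma constant_if_same_vertical:
  assumes c: "0 < c" and d: "0 < d" "d < c" and eq: "P c (0, 1) = P d (0, 1)"
  shows "f x = f y"
proof -
  obtain U where U: "\<And>x y. \<exists>s. \<bar>s\<bar> = (1::real) \<and>
    P d (U x - U y, f (d *\<^sub>R U x) - f (d *\<^sub>R U y)) = s *\<^sub>R P c (x - y, f (c *\<^sub>R x) - f (c *\<^sub>R y))"
    using graph_partner[OF c d(1)] by blast
  have *: "\<bar>f (d *\<^sub>R U x) - f (d *\<^sub>R U y)\<bar> = \<bar>f (c *\<^sub>R x) - f (c *\<^sub>R y)\<bar> \<and> dist (U x) (U y) = dist x y" for x y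
  proof -
    let ?X = "(x - y, f (c *\<^sub>R x) - f (c *\<^sub>R y))" and ?Y = "(U x - U y, f (d *\<^sub>R U x) - f (d *\<^sub>R U y))"
    obtain s where s: "\<bar>s\<bar> = (1::real)" "P d ?Y = s *\<^sub>R P c ?X" using U by blast
    have "P d ?Y \<bullet> P d (0, 1) = s * (P c ?X \<bullet> P c (0, 1))" using s eq by simp
    then have "?Y \<bullet> (0, 1) = s * (?X \<bullet> (0, 1))" by (simp only: inner_P c d)
    then have h: "\<bar>f (d *\<^sub>R U x) - f (d *\<^sub>R U y)\<bar> = \<bar>f (c *\<^sub>R x) - f (c *\<^sub>R y)\<bar>"
      using s(1) by (simp add: abs_mult)
    have "norm ?Y = norm ?X" using s norm_P[OF c, of ?X] norm_P[OF d(1), of ?Y] by simp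
    then have "(norm (U x - U y))\<^sup>2 + (f (d *\<^sub>R U x) - f (d *\<^sub>R U y))\<^sup>2 = (norm (x - y))\<^sup>2 + (f (c *\<^sub>R x) - f (c *\<^sub>R y))\<^sup>2"
      by (simp add: norm_Pair)
    moreover have "(f (d *\<^sub>R U x) - f (d *\<^sub>R U y))\<^sup>2 = (f (c *\<^sub>R x) - f (c *\<^sub>R y))\<^sup>2"
      using h by (metis power2_abs)
    ultimately have "norm (U x - U y) = norm (x - y)" by (simp add: power2_eq_iff_nonneg)
    then show ?thesis using h by (simp add: dist_norm)
  qed
  \<comment> \<open>Rescaling the source by \<open>c\<close> and the target by \<open>d\<close>
    turns the relation between the two dilates into one for \<open>f\<close> itself, with
    contraction ratio \<open>d / c\<close>.\<close>
  define T where "T x = d *\<^sub>R U (x /\<^sub>R c)" for x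
  have "dist (T x) (T y) = d / c * dist x y" for x y
  proof -
    have "dist (T x) (T y) = d * dist (U (x /\<^sub>R c)) (U (y /\<^sub>R c))"
      using d(1) by (simp add: T_def dist_norm scaleR_diff_right[symmetric])
    also have "\<dots> = d * dist (x /\<^sub>R c) (y /\<^sub>R c)" using * by simp
    also have "\<dots> = d / c * dist x y" using c by (simp add: dist_norm scaleR_diff_right[symmetric] divide_inverse)
    finally show ?thesis .
  qed
  moreover have "\<bar>f (T x) - f (T y)\<bar> = \<bar>f x - f y\<bar>" for x y
    using c * by (simp add: T_def)
  ultimately show ?thesis
    using constant_if_contraction_invariant[OF cont, of "d / c" T] c d by simp
qed

text \<open>As \<open>c \<rightarrow> 0\<close>, the horizontal dilations flatten \<open>(u, a)\<close> and \<open>(- u, b)\<close> into opposite directions.\<close>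
lemma line_from_two_sides:
  assumes "(u, a) \<in> Q" "(- u, b) \<in> Q"
  obtains r c where "\<And>k::nat. c k > 0" "(\<lambda>k. P (c k) (u, 0)) \<longlonglongrightarrow> r" "r \<in> Q" "- r \<in> Q"
proof -
  define c where "c k = 1 / (real k + 1)" for k
  have c: "c k > 0" for k by (simp add: c_def)
  have c0: "c \<longlonglongrightarrow> 0"
    unfolding c_def using LIMSEQ_inverse_real_of_nat by (simp add: inverse_eq_divide add.commute)
  have "P (c k) (u, 0) \<in> cball 0 (norm u)" for k
    using norm_P[OF c] by simp
  then obtain s r where s: "strict_mono s" and r: "(\<lambda>k. P (c (s k)) (u, 0)) \<longlonglongrightarrow> r"
    by (rule bounded_sequence_subseq)
  have cs: "(\<lambda>k. c (s k)) \<longlonglongrightarrow> 0"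
    using LIMSEQ_subseq_LIMSEQ[OF c0 s] by (simp add: comp_def)
  have *: "r' \<in> Q" if "(u', a') \<in> Q" and r': "(\<lambda>k. P (c (s k)) (u', 0)) \<longlonglongrightarrow> r'" for u' a' r'
  proof -
    \<comment> \<open>Multiplying by the scale and then undoing the horizontal dilation keeps
      \<open>u'\<close> and shrinks only the height.\<close>
    have "P (c (s k)) (u', c (s k) * a') \<in> Q" for k
      using rec_cone_scaleR[OF that(1), of "c (s k)"] c[of "s k"] by (simp add: cone)
    moreover have "(\<lambda>k. P (c (s k)) (u', c (s k) * a')) \<longlonglongrightarrow> r'"
    proof (rule Lim_transform2[OF r'])
      have "norm (P (c (s k)) (u', 0) - P (c (s k)) (u', c (s k) * a')) = c (s k) * \<bar>a'\<bar>" for k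
        using norm_P[OF c[of "s k"], of "(0, - (c (s k) * a'))"] c[of "s k"]
        by (simp add: linear_diff[OF lin, symmetric] abs_mult)
      moreover have "(\<lambda>k. c (s k) * \<bar>a'\<bar>) \<longlonglongrightarrow> 0 * \<bar>a'\<bar>" by (intro tendsto_intros cs)
      ultimately show "(\<lambda>k. P (c (s k)) (u', 0) - P (c (s k)) (u', c (s k) * a')) \<longlonglongrightarrow> 0"
        by (subst tendsto_norm_zero_iff[symmetric]) simp
    qed
    ultimately show ?thesis by (rule Q_limit)
  qed
  have "P (c (s k)) (- u, 0) = - P (c (s k)) (u, 0)" for k
    using linear_neg[OF lin[OF c], of "s k" "(u, 0)"] by simp
  then have "(\<lambda>k. P (c (s k)) (- u, 0)) \<longlonglongrightarrow> - r"
    using tendsto_minus[OF r] by simp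
  then show thesis
    using that[of "\<lambda>k. c (s k)" r] c r *[OF assms(1) r] *[OF assms(2)] by blast
qed

lemma constant_if_pointed:
  assumes pointed: "\<And>w. w \<in> Q \<Longrightarrow> - w \<in> Q \<Longrightarrow> w = 0"
  shows "f x = f y"
proof -
  \<comment> \<open>These scales tend to infinity. The limit \<open>n\<close> of the images of the
    vertical will span the ray factor of \<open>Q\<close>.\<close>
  define c where "c k = real k + 1" for k
  have c: "c k > 0" for k by (simp add: c_def)
  have "P (c k) (0, 1) \<in> cball 0 1" for k
    using norm_P[OF c] by simp
  then obtain s n where s: "strict_mono s" and n_lim: "(\<lambda>k. P (c (s k)) (0, 1)) \<longlonglongrightarrow> n"
    by (rule bounded_sequence_subseq)
  have "(\<lambda>k. norm (P (c (s k)) (0, 1))) \<longlonglongrightarrow> norm n" by (intro tendsto_intros n_lim)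
  then have norm_n: "norm n = 1" by (simp add: norm_P[OF c] LIMSEQ_const_iff)
  have "filterlim c at_top sequentially"
    unfolding c_def using filterlim_tendsto_add_at_top[OF tendsto_const[of "1::real"] filterlim_real_sequentially]
    by (simp add: add.commute)
  then have cs_top: "filterlim (\<lambda>k. c (s k)) at_top sequentially"
    using filterlim_compose[OF _ filterlim_subseq[OF s]] by blast
  have vert: "P d (0, 1) \<in> Q" if "d > 0" for d
    using that by (simp add: cone rec_cone_vertical)
  have n_Q: "n \<in> Q"
    by (rule Q_limit[OF vert[OF c] n_lim])
  \<comment> \<open>Otherwise, as \<open>c\<close> tends to infinity, the cones would converge to one containing the whole vertical axis.\<close>
  have height: "z \<ge> 0" if "(v, z) \<in> Q" for v z
  proof (rule ccontr)
    assume "\<not> z \<ge> 0"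
    have "P (c (s k)) (v /\<^sub>R c (s k), z) \<in> Q" for k
      using that c[of "s k"] by (simp add: cone)
    moreover have "(\<lambda>k. P (c (s k)) (v /\<^sub>R c (s k), z)) \<longlonglongrightarrow> z *\<^sub>R n"
    proof (rule Lim_transform2)
      show "(\<lambda>k. z *\<^sub>R P (c (s k)) (0, 1)) \<longlonglongrightarrow> z *\<^sub>R n" by (intro tendsto_intros n_lim)
      have "norm (z *\<^sub>R P (c (s k)) (0, 1) - P (c (s k)) (v /\<^sub>R c (s k), z)) = norm v / c (s k)" for k
        using norm_P[OF c[of "s k"], of "(- (v /\<^sub>R c (s k)), 0)"] c[of "s k"]
        by (simp add: linear_diff[OF lin, symmetric] linear_scale[OF lin, symmetric] divide_inverse)
      moreover have "(\<lambda>k. norm v / c (s k)) \<longlonglongrightarrow> 0"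
        by (rule real_tendsto_divide_at_top[OF tendsto_const cs_top])
      ultimately show "(\<lambda>k. z *\<^sub>R P (c (s k)) (0, 1) - P (c (s k)) (v /\<^sub>R c (s k), z)) \<longlonglongrightarrow> 0"
        by (subst tendsto_norm_zero_iff[symmetric]) simp
    qed
    ultimately have "z *\<^sub>R n \<in> Q" by (rule Q_limit)
    from rec_cone_scaleR[OF this, of "- 1 / z"] have "- n \<in> Q"
      using \<open>\<not> z \<ge> 0\<close> by (simp add: divide_nonneg_neg)
    then show False using pointed[OF n_Q] norm_n by simp
  qed
  \<comment> \<open>In the limit the cone becomes a product of a horizontal cone with the ray spanned by \<open>n\<close>.\<close>
  have proj: "q \<bullet> n \<ge> 0 \<and> q - (q \<bullet> n) *\<^sub>R n \<in> Q" if q: "q \<in> Q" for q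
  proof -
    \<comment> \<open>The fixed vector \<open>q\<close> is expressed in the moving frame. Its
      heights converge to \<open>q \<bullet> n\<close>, and its horizontal parts stay
      bounded.\<close>
    have "\<forall>k. \<exists>v z. q = P (c (s k)) (v, z)" using P_surj[OF c] by (metis surj_pair)
    then obtain v z where vz: "\<And>k. q = P (c (s k)) (v k, z k)" by metis
    have z: "z k = q \<bullet> P (c (s k)) (0, 1)" for k
      using inner_P[OF c, of "s k" "(v k, z k)" "(0, 1)"] vz[of k] by simp
    have vQ: "(c (s k) *\<^sub>R v k, z k) \<in> Q" for k
      using q vz[of k] cone[OF c] by metis
    have z0: "z k \<ge> 0" for k using height[OF vQ] .
    have z_lim: "z \<longlonglongrightarrow> q \<bullet> n"
      unfolding z by (intro tendsto_intros n_lim)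
    have "norm (v k) \<le> norm q" for k
      using norm_P[OF c, of "s k" "(v k, z k)"] vz[of k] norm_fst_le[of "v k" "z k"] by simp
    then have "v k \<in> cball 0 (norm q)" for k by simp
    then obtain t w where t: "strict_mono t" and w: "(\<lambda>k. v (t k)) \<longlonglongrightarrow> w"
      by (rule bounded_sequence_subseq)
    have zt: "(\<lambda>k. z (t k)) \<longlonglongrightarrow> q \<bullet> n"
      and nt: "(\<lambda>k. P (c (s (t k))) (0, 1)) \<longlonglongrightarrow> n"
      and ct: "filterlim (\<lambda>k. c (s (t k))) at_top sequentially"
      using LIMSEQ_subseq_LIMSEQ[OF z_lim t] LIMSEQ_subseq_LIMSEQ[OF n_lim t]
        filterlim_compose[OF cs_top filterlim_subseq[OF t]] by (simp_all add: comp_def)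
    \<comment> \<open>Dividing by the scale sends the bounded height to 0 and leaves a horizontal
      direction in the limit.\<close>
    have "(v (t k), z (t k) / c (s (t k))) \<in> Q" for k
      using rec_cone_scaleR[OF vQ[of "t k"], of "1 / c (s (t k))"] c[of "s (t k)"] by simp
    moreover have "(\<lambda>k. (v (t k), z (t k) / c (s (t k)))) \<longlonglongrightarrow> (w, 0)"
      by (intro tendsto_Pair w real_tendsto_divide_at_top[OF zt ct])
    ultimately have "(w, 0) \<in> Q" by (rule Q_limit)
    \<comment> \<open>A horizontal direction of \<open>Q\<close> lies in every horizontal dilation
      of \<open>Q\<close>.\<close>
    then have "P d (w, 0) \<in> Q" if "d > 0" for d
      using rec_cone_scaleR[of "(w, 0)" f d] that by (simp add: cone)
    then have "P (c (s (t k))) (w, 0) \<in> Q" for k using c by blast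
    moreover have "(\<lambda>k. P (c (s (t k))) (w, 0)) \<longlonglongrightarrow> q - (q \<bullet> n) *\<^sub>R n"
    proof (rule Lim_transform2)
      show "(\<lambda>k. q - z (t k) *\<^sub>R P (c (s (t k))) (0, 1)) \<longlonglongrightarrow> q - (q \<bullet> n) *\<^sub>R n"
        by (intro tendsto_intros zt nt)
      have "norm ((q - z (t k) *\<^sub>R P (c (s (t k))) (0, 1)) - P (c (s (t k))) (w, 0)) = norm (v (t k) - w)" for k
      proof -
        have "(q - z (t k) *\<^sub>R P (c (s (t k))) (0, 1)) - P (c (s (t k))) (w, 0) = P (c (s (t k))) (v (t k) - w, 0)"
          unfolding vz[of "t k"] using c[of "s (t k)"]
          by (simp add: linear_diff[OF lin, symmetric] linear_scale[OF lin, symmetric])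
        then show ?thesis using norm_P[OF c] by simp
      qed
      moreover have "(\<lambda>k. norm (v (t k) - w)) \<longlonglongrightarrow> 0"
        using w by (simp add: LIM_zero tendsto_norm_zero)
      ultimately show "(\<lambda>k. (q - z (t k) *\<^sub>R P (c (s (t k))) (0, 1)) - P (c (s (t k))) (w, 0)) \<longlonglongrightarrow> 0"
        by (subst tendsto_norm_zero_iff[symmetric]) simp
    qed
    ultimately have "q - (q \<bullet> n) *\<^sub>R n \<in> Q" by (rule Q_limit)
    moreover have "q \<bullet> n \<ge> 0" using z_lim z0 by (simp add: LIMSEQ_le_const)
    ultimately show ?thesis by simp
  qed
  \<comment> \<open>The horizontal parts of two summands of the vertical are opposite. Flattening
    them gives \<open>r\<close> and \<open>- r\<close> in \<open>Q\<close>, so \<open>r = 0\<close>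
    by pointedness, and since \<open>P\<close> preserves norms these horizontal parts
    vanish.\<close>
  have extreme: "extreme_in Q (P d (0, 1))" if d: "d > 0" for d
    unfolding extreme_in_def
  proof (intro conjI ballI impI)
    show "P d (0, 1) \<in> Q" using vert d .
    fix p q assume p: "p \<in> Q" and q: "q \<in> Q" and sum: "p + q = P d (0, 1)"
    obtain u a where ua: "p = P d (u, a)" using P_surj[OF d, of p] by auto
    have "q = P d (- u, 1 - a)"
      using sum by (simp add: ua eq_diff_eq[symmetric] linear_diff[OF lin[OF d], symmetric] add.commute)
    then have "(d *\<^sub>R u, a) \<in> Q" "(- (d *\<^sub>R u), 1 - a) \<in> Q"
      using p q d by (simp_all add: ua cone)
    then obtain r e where e: "\<And>k::nat. e k > 0" and r: "(\<lambda>k. P (e k) (d *\<^sub>R u, 0)) \<longlonglongrightarrow> r" "r \<in> Q" "- r \<in> Q"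
      using line_from_two_sides by blast
    have "r = 0" using pointed r by blast
    have "(\<lambda>k. norm (P (e k) (d *\<^sub>R u, 0))) \<longlonglongrightarrow> norm r" by (intro tendsto_intros r)
    then have "u = 0" using d by (simp add: norm_P[OF e] \<open>r = 0\<close> LIMSEQ_const_iff)
    then have "p = a *\<^sub>R P d (0, 1)" using d by (simp add: ua linear_scale[OF lin, symmetric])
    then show "\<exists>t. p = t *\<^sub>R P d (0, 1)" ..
  qed
  define K where "K = Q \<inter> {w. n \<bullet> w = 0}"
  have "finite {a. extreme_in K a \<and> norm a = 1}"
  proof (rule finite_extreme_in_plane)
    show "n \<noteq> 0" using norm_n by auto
  qed (auto simp: K_def pointed rec_cone_add rec_cone_scaleR inner_right_distrib)
  moreover have "P d (0, 1) \<in> insert n {a. extreme_in K a \<and> norm a = 1}" if d: "d > 0" for d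
  proof -
    let ?m = "P d (0, 1)"
    have norm_m: "norm ?m = 1" using norm_P[OF d] by simp
    have m: "?m \<in> Q" "?m \<bullet> n \<ge> 0" "?m - (?m \<bullet> n) *\<^sub>R n \<in> Q" using proj[of ?m] vert[OF d] by auto
    have "(?m \<bullet> n) *\<^sub>R n \<in> Q" using rec_cone_scaleR[OF n_Q m(2)] .
    moreover have "(?m \<bullet> n) *\<^sub>R n + (?m - (?m \<bullet> n) *\<^sub>R n) = ?m" by simp
    \<comment> \<open>The component along \<open>n\<close> is a summand of an extreme vector. Hence
      either it vanishes and \<open>?m\<close> lies in \<open>K\<close>, or \<open>?m\<close> is
      parallel to \<open>n\<close>.\<close>
    ultimately obtain t where t: "(?m \<bullet> n) *\<^sub>R n = t *\<^sub>R ?m"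
      using extreme[OF d] m(3) unfolding extreme_in_def by blast
    show ?thesis
    proof (cases "?m \<bullet> n = 0")
      case True
      then have "extreme_in K ?m"
        using extreme[OF d] by (auto simp: extreme_in_def K_def inner_commute)
      then show ?thesis using norm_m by simp
    next
      case False
      have "norm ((?m \<bullet> n) *\<^sub>R n) = norm (t *\<^sub>R ?m)" using t by simp
      then have "\<bar>t\<bar> = ?m \<bullet> n" using norm_n norm_m m(2) by simp
      then have "t = ?m \<bullet> n \<or> t = - (?m \<bullet> n)" by linarith
      then have "n = ?m \<or> n = - ?m"
      proof
        assume "t = - (?m \<bullet> n)"
        then have "(?m \<bullet> n) *\<^sub>R n = (?m \<bullet> n) *\<^sub>R (- ?m)" using t by simp
        then show ?thesis using False scaleR_cancel_left by blast
      qed (use t False in simp)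
      then have "n = ?m" using pointed[OF m(1)] n_Q norm_n by auto
      then show ?thesis by simp
    qed
  qed
  ultimately have "finite ((\<lambda>d. P d (0, 1)) ` {0<..})"
    by (meson finite_insert finite_subset greaterThan_iff image_subsetI)
  then have "\<not> inj_on (\<lambda>d. P d (0, 1)) {0<..}"
    using finite_imageD infinite_Ioi by blast
  then obtain d d' where "0 < d" "0 < d'" "d \<noteq> d'" "P d (0, 1) = P d' (0, 1)"
    unfolding inj_on_def by auto
  then show ?thesis
    using constant_if_same_vertical[of d d' x y] constant_if_same_vertical[of d' d x y]
    by (cases d d' rule: linorder_cases) auto
qed

end

section \<open>Recession cones containing a line\<close>

lemma real2_frame:
  fixes v :: "real^2"
  assumes "norm v = 1"
  shows "\<exists>v' :: real^2. norm v' = 1 \<and> v \<bullet> v' = 0 \<and> (\<forall>x. x = (x \<bullet> v) *\<^sub>R v + (x \<bullet> v') *\<^sub>R v')"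
proof (intro exI conjI allI)
  \<comment> \<open>This is \<open>v\<close> turned by a right angle.\<close>
  let ?v' = "vector [- (v $ 2), v $ 1] :: real^2"
  have v: "v $ 1 * v $ 1 + v $ 2 * v $ 2 = 1"
    using assms by (simp add: norm_eq_1 inner_vec_def sum_2)
  then show "norm ?v' = 1" by (simp add: norm_eq_1 inner_vec_def sum_2 algebra_simps)
  show "v \<bullet> ?v' = 0" by (simp add: inner_vec_def sum_2)
  show "x = (x \<bullet> v) *\<^sub>R v + (x \<bullet> ?v') *\<^sub>R ?v'" for x
  proof -
    have "x $ 1 = (x $ 1 * v $ 1 + x $ 2 * v $ 2) * v $ 1 + (- (x $ 1 * v $ 2) + x $ 2 * v $ 1) * - (v $ 2)"
      "x $ 2 = (x $ 1 * v $ 1 + x $ 2 * v $ 2) * v $ 2 + (- (x $ 1 * v $ 2) + x $ 2 * v $ 1) * v $ 1"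
      using v by algebra+
    then show ?thesis by (simp add: vec_eq_iff forall_2 inner_vec_def sum_2)
  qed
qed

text \<open>The setting of a proof by contradiction: \<open>g\<close> is the profile of
  \<open>f\<close> across the line, and \<open>not_affine\<close> will exclude any second
  independent line in the cone.\<close>

locale rigid_line = rigid_frame +
  fixes v v' :: "real^2" and m :: real and g :: "real \<Rightarrow> real"
  assumes norms: "norm v = 1" "norm v' = 1" and perp: "v \<bullet> v' = 0"
    and frame: "x = (x \<bullet> v) *\<^sub>R v + (x \<bullet> v') *\<^sub>R v'"
    and f_eq: "f x = g (x \<bullet> v') + (x \<bullet> v) * m"
    and not_affine: "\<nexists>a w. \<forall>x. f x = a + w \<bullet> x"
begin

lemma vv: "v \<bullet> v = 1" "v' \<bullet> v' = 1" "v' \<bullet> v = 0" "v \<bullet> v' = 0"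
  using norms perp by (simp_all add: norm_eq_1 inner_commute)

lemma g_eq: "g y = f (y *\<^sub>R v')"
  by (simp add: f_eq vv)

lemma g_cont: "continuous_on UNIV g"
  unfolding g_eq[abs_def] by (intro continuous_on_compose2[OF cont] continuous_intros) auto

lemma shift: "f (x + t *\<^sub>R v) = f x + t * m"
  by (simp add: f_eq vv inner_left_distrib algebra_simps)

definition ell :: "(real^2) \<times> real" where "ell = (v, m)"

lemma ell_pos: "ell \<bullet> ell > 0"
  by (simp add: ell_def vv add_pos_nonneg)

lemma ell_nonzero: "ell \<noteq> 0"
  using ell_pos by auto

lemma ell_line: "t *\<^sub>R ell \<in> Q"
  using rec_cone_lineI[of f "t *\<^sub>R v" "t * m"] shift by (simp add: ell_def mult.assoc)

text \<open>A line with a nonzero component along \<open>v'\<close> would make \<open>g\<close>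
  affine, and hence \<open>f\<close> too. A line along \<open>v\<close> must have the slope
  \<open>m\<close>.\<close>

lemma lineality_space:
  assumes w: "w \<in> Q" "- w \<in> Q"
  shows "w = (fst w \<bullet> v) *\<^sub>R ell"
proof -
  obtain u k where uk: "w = (u, k)" by (cases w)
  have shift_u: "f (x + t *\<^sub>R u) = f x + t * k" for x t
    using w by (intro rec_cone_line) (auto simp: uk)
  let ?\<alpha> = "u \<bullet> v" and ?\<beta> = "u \<bullet> v'"
  have "?\<beta> = 0"
  proof (rule ccontr)
    assume \<beta>: "?\<beta> \<noteq> 0"
    have g_lin: "g y = g 0 + y * ((k - ?\<alpha> * m) / ?\<beta>)" for y
    proof -
      have "g y + (y / ?\<beta>) * ?\<alpha> * m = f ((y / ?\<beta>) *\<^sub>R u)"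
        using \<beta> by (simp add: f_eq)
      also have "\<dots> = g 0 + (y / ?\<beta>) * k"
        using shift_u[of 0 "y / ?\<beta>"] g_eq[of 0] by simp
      finally show ?thesis by (simp add: algebra_simps diff_divide_distrib)
    qed
    have "f x = g 0 + (((k - ?\<alpha> * m) / ?\<beta>) *\<^sub>R v' + m *\<^sub>R v) \<bullet> x" for x
      unfolding f_eq[of x] g_lin[of "x \<bullet> v'"] by (simp add: inner_left_distrib inner_commute[of x])
    then show False using not_affine by blast
  qed
  then have u: "u = ?\<alpha> *\<^sub>R v" using frame[of u] by simp
  have "k = ?\<alpha> * m"
    using shift_u[of 0 1] shift[of 0 ?\<alpha>] u by simp
  then show ?thesis using u by (simp add: uk ell_def)
qed

text \<open>
  \<open>l c\<close> spans the line contained in the recession cone of \<open>\<lambda>x. f (c *\<^sub>R x)\<close>, and \<open>w c\<close> is the unit normal to it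
  in the plane spanned by \<open>v\<close> and the vertical axis. The section of the graph perpendicular to \<open>l c\<close> is the
  graph of \<open>\<lambda>y. g (c * y) / N c\<close>.
\<close>
definition N :: "real \<Rightarrow> real" where "N c = sqrt (1 + m\<^sup>2 * c\<^sup>2)"
definition l :: "real \<Rightarrow> (real^2) \<times> real" where "l c = (v, m * c)"
definition w :: "real \<Rightarrow> (real^2) \<times> real" where "w c = (1 / N c) *\<^sub>R (- (m * c) *\<^sub>R v, 1)"
text \<open>\<open>q c\<close> takes over from \<open>P c (0, 1)\<close> in the pointed case, inside
  the planar pointed cone \<open>K\<close>.\<close>

definition q :: "real \<Rightarrow> (real^2) \<times> real" where "q c = P c (w c)"
definition K :: "((real^2) \<times> real) set" where "K = Q \<inter> {X. ell \<bullet> X = 0}"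

lemma N2: "(N c)\<^sup>2 = 1 + m\<^sup>2 * c\<^sup>2" and N1: "N c \<ge> 1"
  by (simp_all add: N_def)

lemma N0: "N c > 0"
  using N1[of c] by linarith

lemma Nw: "N c *\<^sub>R w c = (- (m * c) *\<^sub>R v, 1)"
  using N0[of c] by (simp add: w_def)

lemma w_l: "w c \<bullet> l c = 0"
  by (simp add: w_def l_def vv)

lemma l_l: "l c \<bullet> l c = (N c)\<^sup>2"
  unfolding N2 by (simp add: l_def vv power2_eq_square)

lemma norm_w: "norm (w c) = 1"
proof -
  have "(N c)\<^sup>2 * (w c \<bullet> w c) = (N c *\<^sub>R w c) \<bullet> (N c *\<^sub>R w c)"
    by (simp add: power2_eq_square)
  also have "\<dots> = (N c)\<^sup>2" unfolding Nw N2 by (simp add: vv power2_eq_square)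
  finally show ?thesis using N0[of c] by (simp add: norm_eq_1)
qed

text \<open>Both \<open>l c\<close> and its negative lie in the cone of
  \<open>f (c \<cdot>)\<close>, so their images span a line in \<open>Q\<close>, which must be that
  of \<open>ell\<close>.\<close>

lemma P_l:
  assumes c: "c > 0"
  shows "\<exists>\<tau>. P c (l c) = \<tau> *\<^sub>R ell"
proof -
  have "P c (l c) \<in> Q" "P c (- l c) \<in> Q"
    using ell_line[of c] ell_line[of "- c"] c by (simp_all add: cone l_def ell_def mult.commute)
  then show ?thesis
    using lineality_space[of "P c (l c)"] linear_neg[OF lin[OF c], of "l c"] by auto
qed

lemma l_inner:
  assumes c: "c > 0"
  obtains \<tau> where "\<And>X. X \<bullet> l c = \<tau> * (P c X \<bullet> ell)" "\<tau>\<^sup>2 * (ell \<bullet> ell) = (N c)\<^sup>2" "\<tau> \<noteq> 0"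
proof -
  obtain \<tau> where \<tau>: "P c (l c) = \<tau> *\<^sub>R ell" using P_l[OF c] by blast
  have 1: "X \<bullet> l c = \<tau> * (P c X \<bullet> ell)" for X
    using inner_P[OF c, of X "l c"] \<tau> by simp
  have 2: "\<tau>\<^sup>2 * (ell \<bullet> ell) = (N c)\<^sup>2"
    using inner_P[OF c, of "l c" "l c"] \<tau> by (simp add: l_l power2_eq_square)
  then have "\<tau> \<noteq> 0" using N0[of c] by auto
  with 1 2 show thesis using that by blast
qed

lemma P_perp_iff:
  assumes "c > 0"
  shows "ell \<bullet> P c X = 0 \<longleftrightarrow> X \<bullet> l c = 0"
proof -
  obtain \<tau> where "\<And>X. X \<bullet> l c = \<tau> * (P c X \<bullet> ell)" "\<tau> \<noteq> 0"
    using l_inner[OF assms] by blast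
  then show ?thesis by (simp add: inner_commute)
qed

lemma K_pointed:
  assumes "X \<in> K" "- X \<in> K"
  shows "X = 0"
proof -
  have X: "X = (fst X \<bullet> v) *\<^sub>R ell"
    using assms by (intro lineality_space) (auto simp: K_def)
  have "ell \<bullet> X = (fst X \<bullet> v) * (ell \<bullet> ell)" by (subst X) simp
  then have "fst X \<bullet> v = 0" using assms ell_pos by (simp add: K_def)
  then show ?thesis using X by simp
qed

lemma q_K:
  assumes c: "c > 0"
  shows "q c \<in> K"
proof -
  \<comment> \<open>This is the horizontal dilation by \<open>c\<close> of
    \<open>N c *\<^sub>R w c\<close>, written as a vector on the line plus an upward one.\<close>
  have "(- (m * c\<^sup>2)) *\<^sub>R ell + (0, 1 + m\<^sup>2 * c\<^sup>2) \<in> Q"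
    by (intro rec_cone_add ell_line) (simp add: rec_cone_vertical)
  then have "P c (- (m * c) *\<^sub>R v, 1) \<in> Q"
    using c by (simp add: cone ell_def power2_eq_square algebra_simps)
  then have "N c *\<^sub>R q c \<in> Q" unfolding q_def Nw[symmetric] linear_scale[OF lin[OF c]] .
  from rec_cone_scaleR[OF this, of "1 / N c"] have "q c \<in> Q" using N0[of c] by simp
  moreover have "ell \<bullet> q c = 0"
    using P_perp_iff[OF c] w_l by (simp add: q_def)
  ultimately show ?thesis by (simp add: K_def)
qed

text \<open>The first part expands \<open>Z\<close>, which is perpendicular to \<open>l c\<close>,
  in the orthonormal pair \<open>(v', 0)\<close>, \<open>w c\<close>. The second adds the multiple
  of \<open>ell\<close> that cancels the \<open>v\<close> component of the dilated vector.\<close>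

lemma K_coordinates:
  assumes c: "c > 0" and Z: "P c Z \<in> K"
  shows "Z = (fst Z \<bullet> v') *\<^sub>R (v', 0) + (snd Z * N c) *\<^sub>R w c"
    and "((c * (fst Z \<bullet> v')) *\<^sub>R v', snd Z * (N c)\<^sup>2) \<in> Q"
proof -
  obtain x z where xz: "Z = (x, z)" by (cases Z)
  have "Z \<bullet> l c = 0" using P_perp_iff[OF c] Z by (simp add: K_def)
  then have xv: "x \<bullet> v = - (m * c * z)" by (simp add: xz l_def algebra_simps)
  have x: "x = - (m * c * z) *\<^sub>R v + (x \<bullet> v') *\<^sub>R v'" using frame[of x] unfolding xv .
  have "(snd Z * N c) *\<^sub>R w c = z *\<^sub>R (N c *\<^sub>R w c)" by (simp add: xz)
  also have "\<dots> = (- (m * c * z) *\<^sub>R v, z)" unfolding Nw by (simp add: algebra_simps)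
  finally have "(fst Z \<bullet> v') *\<^sub>R (v', 0) + (snd Z * N c) *\<^sub>R w c = (- (m * c * z) *\<^sub>R v + (x \<bullet> v') *\<^sub>R v', z)"
    by (simp add: xz)
  also have "\<dots> = Z" using x by (simp add: xz)
  finally show "Z = (fst Z \<bullet> v') *\<^sub>R (v', 0) + (snd Z * N c) *\<^sub>R w c" ..
  have "(c *\<^sub>R x, z) \<in> Q" using Z c cone[OF c, of x z] by (simp add: xz K_def)
  then have "(c *\<^sub>R x, z) + (m * c\<^sup>2 * z) *\<^sub>R ell \<in> Q" by (intro rec_cone_add ell_line)
  moreover have "c *\<^sub>R x + (m * c\<^sup>2 * z) *\<^sub>R v = (c * (x \<bullet> v')) *\<^sub>R v'"
  proof -
    have "c *\<^sub>R x = c *\<^sub>R (- (m * c * z) *\<^sub>R v + (x \<bullet> v') *\<^sub>R v')" using x by (rule arg_cong)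
    then show ?thesis by (simp add: algebra_simps power2_eq_square)
  qed
  moreover have "z + m * c\<^sup>2 * z * m = z * (N c)\<^sup>2"
    unfolding N2 by (simp add: algebra_simps power2_eq_square)
  ultimately show "((c * (fst Z \<bullet> v')) *\<^sub>R v', snd Z * (N c)\<^sup>2) \<in> Q" by (simp add: xz ell_def)
qed

text \<open>As in the pointed case, the \<open>v'\<close> components of two summands are opposite
  and flatten to \<open>r\<close> and \<open>- r\<close> in \<open>Q\<close>. The limit stays
  perpendicular to \<open>ell\<close>, so pointedness of \<open>K\<close> suffices.\<close>

lemma q_extreme:
  assumes c: "c > 0"
  shows "extreme_in K (q c)"
  unfolding extreme_in_def
proof (intro conjI ballI impI)
  show "q c \<in> K" using q_K c .
  fix p p' assume p: "p \<in> K" and p': "p' \<in> K" and sum: "p + p' = q c"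
  obtain X where X: "p = P c X" using P_surj[OF c] by blast
  obtain Y where Y: "p' = P c Y" using P_surj[OF c] by blast
  have "P c (X + Y) = P c (w c)"
    using sum lin[OF c] by (simp add: X Y q_def linear_add)
  then have XY: "X + Y = w c" using orthogonal_transformation_inj[OF orth[OF c]] by (simp add: inj_eq)
  have "fst X \<bullet> v' + fst Y \<bullet> v' = fst (w c) \<bullet> v'"
    unfolding XY[symmetric] by (simp add: inner_left_distrib)
  then have Yv: "fst Y \<bullet> v' = - (fst X \<bullet> v')" by (simp add: w_def vv)
  let ?u = "(c * (fst X \<bullet> v')) *\<^sub>R v'"
  have "(?u, snd X * (N c)\<^sup>2) \<in> Q" "(- ?u, snd Y * (N c)\<^sup>2) \<in> Q"
    using K_coordinates(2)[OF c, of X] K_coordinates(2)[OF c, of Y] p p' by (simp_all add: X Y Yv)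
  then obtain r e where e: "\<And>k::nat. e k > 0" and r: "(\<lambda>k. P (e k) (?u, 0)) \<longlonglongrightarrow> r" "r \<in> Q" "- r \<in> Q"
    by (rule line_from_two_sides) blast
  have "ell \<bullet> P (e k) (?u, 0) = 0" for k
    using P_perp_iff[OF e, of k] by (simp add: l_def vv)
  moreover have "(\<lambda>k. ell \<bullet> P (e k) (?u, 0)) \<longlonglongrightarrow> ell \<bullet> r" by (intro tendsto_intros r)
  ultimately have "ell \<bullet> r = 0" by (simp add: LIMSEQ_const_iff)
  then have r0: "r = 0" using r K_pointed[of r] by (simp add: K_def)
  have "(\<lambda>k. norm (P (e k) (?u, 0))) \<longlonglongrightarrow> norm r" by (intro tendsto_intros r)
  then have "fst X \<bullet> v' = 0" using c norms by (simp add: norm_P[OF e] r0 LIMSEQ_const_iff)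
  then have "X = (snd X * N c) *\<^sub>R w c"
    using K_coordinates(1)[OF c, of X] p X by (simp add: zero_prod_def[symmetric])
  then have "p = P c ((snd X * N c) *\<^sub>R w c)" using X by simp
  then have "p = (snd X * N c) *\<^sub>R q c" using lin[OF c] by (simp add: q_def linear_scale)
  then show "\<exists>t. p = t *\<^sub>R q c" ..
qed

lemma finite_q: "finite {a. extreme_in K a \<and> norm a = 1}"
proof (rule finite_extreme_in_plane)
  show "ell \<noteq> 0" by (rule ell_nonzero)
  show "X = 0" if "X \<in> K" "- X \<in> K" for X using K_pointed that .
qed (auto simp: K_def rec_cone_add rec_cone_scaleR inner_right_distrib)

text \<open>The slope of \<open>w e\<close> is such that the linear part of \<open>f\<close> along
  \<open>v\<close> cancels.\<close>

lemma Nw_inner: "N e * ((x - y, f (e *\<^sub>R x) - f (e *\<^sub>R y)) \<bullet> w e) = g (e * (x \<bullet> v')) - g (e * (y \<bullet> v'))"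
proof -
  have "N e * ((x - y, f (e *\<^sub>R x) - f (e *\<^sub>R y)) \<bullet> w e) = (x - y, f (e *\<^sub>R x) - f (e *\<^sub>R y)) \<bullet> (N e *\<^sub>R w e)"
    by simp
  also have "\<dots> = g (e * (x \<bullet> v')) - g (e * (y \<bullet> v'))"
    unfolding Nw by (simp add: f_eq inner_diff_left algebra_simps)
  finally show ?thesis .
qed

text \<open>Pythagoras in the orthogonal frame \<open>(v', 0)\<close>, \<open>l e\<close>,
  \<open>w e\<close>. The component along \<open>l e\<close> is expressed through
  \<open>ell\<close>, which makes different scales comparable.\<close>

lemma norm_split:
  assumes e: "e > 0"
  shows "Z \<bullet> Z = (fst Z \<bullet> v')\<^sup>2 + (P e Z \<bullet> ell)\<^sup>2 / (ell \<bullet> ell) + (Z \<bullet> w e)\<^sup>2"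
proof -
  obtain x z where xz: "Z = (x, z)" by (cases Z)
  obtain \<tau> where \<tau>: "\<And>X. X \<bullet> l e = \<tau> * (P e X \<bullet> ell)" "\<tau>\<^sup>2 * (ell \<bullet> ell) = (N e)\<^sup>2"
    using l_inner[OF e] by blast
  have "x \<bullet> x = ((x \<bullet> v) *\<^sub>R v + (x \<bullet> v') *\<^sub>R v') \<bullet> x" using frame[of x] by simp
  also have "\<dots> = (x \<bullet> v)\<^sup>2 + (x \<bullet> v')\<^sup>2"
    by (simp add: inner_left_distrib inner_commute[of x] power2_eq_square)
  finally have xx: "x \<bullet> x = (x \<bullet> v)\<^sup>2 + (x \<bullet> v')\<^sup>2" .
  have "N e * (Z \<bullet> w e) = Z \<bullet> (N e *\<^sub>R w e)" by simp
  also have "\<dots> = z - m * e * (x \<bullet> v)" unfolding Nw by (simp add: xz)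
  finally have "(N e)\<^sup>2 * (Z \<bullet> w e)\<^sup>2 = (z - m * e * (x \<bullet> v))\<^sup>2" by (simp add: power_mult_distrib[symmetric])
  moreover have "(N e)\<^sup>2 * ((P e Z \<bullet> ell)\<^sup>2 / (ell \<bullet> ell)) = (x \<bullet> v + m * e * z)\<^sup>2"
  proof -
    have "x \<bullet> v + m * e * z = \<tau> * (P e Z \<bullet> ell)"
      using \<tau>(1)[of Z] by (simp add: xz l_def algebra_simps)
    then have "(x \<bullet> v + m * e * z)\<^sup>2 = \<tau>\<^sup>2 * (P e Z \<bullet> ell)\<^sup>2" by (simp add: power_mult_distrib)
    then show ?thesis unfolding \<tau>(2)[symmetric] using ell_pos by simp
  qed
  moreover have "(N e)\<^sup>2 * ((x \<bullet> v)\<^sup>2 + z\<^sup>2) = (x \<bullet> v + m * e * z)\<^sup>2 + (z - m * e * (x \<bullet> v))\<^sup>2"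
    unfolding N2 by algebra
  ultimately have "(N e)\<^sup>2 * (Z \<bullet> Z) = (N e)\<^sup>2 * ((fst Z \<bullet> v')\<^sup>2 + (P e Z \<bullet> ell)\<^sup>2 / (ell \<bullet> ell) + (Z \<bullet> w e)\<^sup>2)"
    by (simp add: xz xx distrib_left power2_eq_square[of z])
  then show ?thesis using N0[of e] by (simp only: mult_cancel_left) auto
qed

text \<open>Corresponding differences agree up to sign along the common vector \<open>q d\<close>
  and along \<open>ell\<close>. By \<open>norm_split\<close> they also agree along
  \<open>v'\<close>, while \<open>Nw_inner\<close> brings in the ratio of the values of
  \<open>N\<close>.\<close>

lemma profile_map:
  assumes d: "d > 0" "d' > 0" and eq: "q d = q d'"
  obtains T where "\<And>x y. dist (T x) (T y) = d' / d * dist x y"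
    "\<And>x y. \<bar>g (T x) - g (T y)\<bar> = N d' / N d * \<bar>g x - g y\<bar>"
proof -
  obtain U where U: "\<And>x y. \<exists>s. \<bar>s\<bar> = (1::real) \<and>
    P d' (U x - U y, f (d' *\<^sub>R U x) - f (d' *\<^sub>R U y)) = s *\<^sub>R P d (x - y, f (d *\<^sub>R x) - f (d *\<^sub>R y))"
    using graph_partner[OF d] by blast
  have *: "\<bar>g (d' * (U x \<bullet> v')) - g (d' * (U y \<bullet> v'))\<bar> = N d' / N d * \<bar>g (d * (x \<bullet> v')) - g (d * (y \<bullet> v'))\<bar> \<and>
    \<bar>U x \<bullet> v' - U y \<bullet> v'\<bar> = \<bar>x \<bullet> v' - y \<bullet> v'\<bar>" for x y
  proof -
    define X where "X = (x - y, f (d *\<^sub>R x) - f (d *\<^sub>R y))"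
    define Y where "Y = (U x - U y, f (d' *\<^sub>R U x) - f (d' *\<^sub>R U y))"
    obtain s where s: "\<bar>s\<bar> = (1::real)" "P d' Y = s *\<^sub>R P d X" using U unfolding X_def Y_def by blast
    have s2: "s\<^sup>2 = 1" using s(1) power2_abs[of s] by simp
    have "P d' Y \<bullet> q d' = s * (P d X \<bullet> q d)" using s eq by simp
    then have "Y \<bullet> w d' = s * (X \<bullet> w d)" unfolding q_def by (simp only: inner_P d)
    then have w_eq: "\<bar>Y \<bullet> w d'\<bar> = \<bar>X \<bullet> w d\<bar>" using s(1) by (simp add: abs_mult)
    have "\<bar>g (d' * (U x \<bullet> v')) - g (d' * (U y \<bullet> v'))\<bar> = N d' * \<bar>Y \<bullet> w d'\<bar>"
      unfolding Nw_inner[symmetric] abs_mult Y_def using N0[of d'] by simp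
    also have "\<dots> = N d' / N d * (N d * \<bar>X \<bullet> w d\<bar>)" unfolding w_eq using N0[of d] by simp
    also have "N d * \<bar>X \<bullet> w d\<bar> = \<bar>g (d * (x \<bullet> v')) - g (d * (y \<bullet> v'))\<bar>"
      unfolding Nw_inner[symmetric] abs_mult X_def using N0[of d] by simp
    finally have 1: "\<bar>g (d' * (U x \<bullet> v')) - g (d' * (U y \<bullet> v'))\<bar> = N d' / N d * \<bar>g (d * (x \<bullet> v')) - g (d * (y \<bullet> v'))\<bar>" .
    have "Y \<bullet> Y = P d' Y \<bullet> P d' Y" using inner_P[OF d(2)] by simp
    also have "\<dots> = s\<^sup>2 * (P d X \<bullet> P d X)" unfolding s(2) by (simp add: power2_eq_square)
    also have "\<dots> = X \<bullet> X" using inner_P[OF d(1)] s2 by simp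
    finally have "Y \<bullet> Y = X \<bullet> X" .
    moreover have "(P d' Y \<bullet> ell)\<^sup>2 = (P d X \<bullet> ell)\<^sup>2"
      unfolding s(2) by (simp add: power_mult_distrib s2)
    moreover have "(Y \<bullet> w d')\<^sup>2 = (X \<bullet> w d)\<^sup>2" using w_eq power2_abs by metis
    ultimately have "(fst Y \<bullet> v')\<^sup>2 = (fst X \<bullet> v')\<^sup>2"
      using norm_split[OF d(2), of Y] norm_split[OF d(1), of X] by simp
    then have "\<bar>fst Y \<bullet> v'\<bar> = \<bar>fst X \<bullet> v'\<bar>" by (simp add: power2_eq_iff abs_eq_iff)
    then show ?thesis using 1 by (simp add: X_def Y_def inner_diff_left)
  qed
  \<comment> \<open>The correspondence is restricted to the line spanned by \<open>v'\<close> and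
    rescaled as in the planar case.\<close>
  define T where "T y = d' * (U ((y / d) *\<^sub>R v') \<bullet> v')" for y
  have "dist (T x) (T y) = d' / d * dist x y" for x y
  proof -
    have "dist (T x) (T y) = d' * \<bar>U ((x / d) *\<^sub>R v') \<bullet> v' - U ((y / d) *\<^sub>R v') \<bullet> v'\<bar>"
      using d by (simp add: T_def dist_real_def right_diff_distrib[symmetric] abs_mult)
    also have "\<dots> = d' * \<bar>x / d - y / d\<bar>" using * by (simp add: vv)
    also have "\<dots> = d' / d * dist x y"
      using d by (simp add: dist_real_def diff_divide_distrib[symmetric])
    finally show ?thesis .
  qed
  moreover have "\<bar>g (T x) - g (T y)\<bar> = N d' / N d * \<bar>g x - g y\<bar>" for x y
    using *[of "(x / d) *\<^sub>R v'" "(y / d) *\<^sub>R v'"] d by (simp add: T_def vv)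
  ultimately show thesis by (rule that)
qed

lemma g_const: "g x = g y"
proof -
  define c where "c k = 1 / (real k + 1)" for k
  have c: "c k > 0" for k by (simp add: c_def)
  have c_less: "c j < c k" if "k < j" for j k using that by (simp add: c_def frac_less2)
  \<comment> \<open>Only finitely many vectors are available, so one of them serves infinitely many
    indices and thus arbitrarily small scales.\<close>
  have "\<forall>k\<in>UNIV. \<exists>a\<in>{a. extreme_in K a \<and> norm a = 1}. q (c k) = a"
    using q_extreme[OF c] norm_P[OF c] norm_w by (simp add: q_def)
  from pigeonhole_infinite_rel[OF infinite_UNIV_nat finite_q this]
  obtain q0 where W: "infinite {k. q (c k) = q0}" by auto
  have W_unbounded: "\<exists>k>j. q (c k) = q0" for j
    using W unfolding infinite_nat_iff_unbounded by blast
  obtain i where i: "q (c i) = q0" using W_unbounded by blast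
  obtain k where k: "i < k" "q (c k) = q0" using W_unbounded by blast
  have q_ik: "q (c i) = q (c k)" using i k by simp
  show ?thesis
  proof (cases "m = 0")
    case True
    obtain T where T: "\<And>x y. dist (T x) (T y) = c k / c i * dist x y"
      "\<And>x y. \<bar>g (T x) - g (T y)\<bar> = N (c k) / N (c i) * \<bar>g x - g y\<bar>"
      using profile_map[OF c c q_ik] by blast
    have "N d = 1" for d unfolding N_def using True by simp
    then have "N (c k) / N (c i) = 1" by simp
    then have "\<bar>g (T x) - g (T y)\<bar> = \<bar>g x - g y\<bar>" for x y using T(2) by simp
    moreover have "0 \<le> c k / c i" "c k / c i < 1" using c[of i] c[of k] c_less[OF k(1)] by auto
    ultimately show ?thesis
      using constant_if_contraction_invariant[OF g_cont _ _ T(1)] by blast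
  next
    case False
    obtain T where T: "\<And>x y. dist (T x) (T y) = c i / c k * dist x y"
      "\<And>x y. \<bar>g (T x) - g (T y)\<bar> = N (c i) / N (c k) * \<bar>g x - g y\<bar>"
      using profile_map[OF c c q_ik[symmetric]] by blast
    have ratio: "1 < c i / c k" using c[of k] c_less[OF k(1)] by simp
    have "(c k)\<^sup>2 < (c i)\<^sup>2" using c[of k] c_less[OF k(1)] by (intro power_strict_mono) auto
    then have "N (c k) < N (c i)" using False by (simp add: N_def)
    then have "1 < N (c i) / N (c k)" using N0[of "c k"] by simp
    \<comment> \<open>The contraction to come multiplies differences by at least
      \<open>1 / N (c i)\<close>, because \<open>N\<close> is at least 1. The \<open>j\<close>-th
      power of the expansion outweighs this loss in advance.\<close>
    then obtain j where j: "N (c i) < (N (c i) / N (c k)) ^ j" using real_arch_pow by blast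
    have "j > 0" using j N1[of "c i"] by (cases j) auto
    \<comment> \<open>With \<open>j\<close> fixed, \<open>n\<close> is taken so large that going
      down to scale \<open>c n\<close> undoes the expansion of distances by the \<open>j\<close>-th
      iterate of \<open>T\<close>.\<close>
    obtain b where b: "(c i / c k) ^ j / c i < real b" using reals_Archimedean2 by blast
    obtain n where n: "b < n" "q (c n) = q0" using W_unbounded by blast
    have q_in: "q (c i) = q (c n)" using i n by simp
    obtain B where B: "\<And>x y. dist (B x) (B y) = c n / c i * dist x y"
      "\<And>x y. \<bar>g (B x) - g (B y)\<bar> = N (c n) / N (c i) * \<bar>g x - g y\<bar>"
      using profile_map[OF c c q_in] by blast
    have small: "(c i / c k) ^ j * (c n / c i) \<le> 1"
    proof -
      have "(c i / c k) ^ j / c i \<le> real n + 1" using b n by linarith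
      then have "(c i / c k) ^ j / c i * c n \<le> (real n + 1) * c n" using c[of n] by (intro mult_right_mono) auto
      also have "\<dots> = 1" by (simp add: c_def)
      finally show ?thesis by simp
    qed
    have large: "1 < (N (c i) / N (c k)) ^ j * (N (c n) / N (c i))"
    proof -
      have "1 \<le> N (c n)" using N1 .
      also have "\<dots> = N (c i) * (N (c n) / N (c i))" using N0[of "c i"] by simp
      also have "\<dots> < (N (c i) / N (c k)) ^ j * (N (c n) / N (c i))"
        using j N0 by (intro mult_strict_right_mono) auto
      finally show ?thesis .
    qed
    have "0 < c n / c i" using c by simp
    then show ?thesis
      using constant_if_expansion_contraction[OF g_cont dist_funpow[of T, OF T(1)]
          one_less_power[OF ratio \<open>j > 0\<close>] diff_funpow[of g T, OF T(2)] B(1) _ small B(2) large]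
      by blast
  qed
qed

lemma contradiction: False
proof -
  have "f x = g 0 + (m *\<^sub>R v) \<bullet> x" for x
    using f_eq[of x] g_const[of "x \<bullet> v'" 0] by (simp add: inner_commute)
  then show False using not_affine by blast
qed

end

lemma (in rigid_frame) affine_if_unit_line:
  assumes v: "norm v = 1" and line: "(v, m) \<in> Q" "(- v, - m) \<in> Q"
  shows "\<exists>a w. \<forall>x. f x = a + w \<bullet> x"
proof (rule ccontr)
  assume not_affine: "\<nexists>a w. \<forall>x. f x = a + w \<bullet> x"
  obtain v' where v': "norm v' = 1" "v \<bullet> v' = 0"
    and frame: "\<forall>x. x = (x \<bullet> v) *\<^sub>R v + (x \<bullet> v') *\<^sub>R v'"
    using real2_frame[OF v] by blast
  have profile: "f x = f ((x \<bullet> v') *\<^sub>R v') + (x \<bullet> v) * m" for x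
  proof -
    have "f x = f ((x \<bullet> v') *\<^sub>R v' + (x \<bullet> v) *\<^sub>R v)"
      using frame by (metis add.commute)
    then show ?thesis using rec_cone_line[OF line, of "(x \<bullet> v') *\<^sub>R v'" "x \<bullet> v"] by simp
  qed
  interpret rigid_line f P v v' m "\<lambda>y. f (y *\<^sub>R v')"
  proof unfold_locales
    show "x = (x \<bullet> v) *\<^sub>R v + (x \<bullet> v') *\<^sub>R v'" for x using frame by blast
  qed (fact v v' profile not_affine)+
  show False by (rule contradiction)
qed

section \<open>Rigidity and affinity\<close>

lemma (in rigid_frame) affine: "\<exists>a w. \<forall>x. f x = a + w \<bullet> x"
proof (cases "\<forall>w. w \<in> Q \<longrightarrow> - w \<in> Q \<longrightarrow> w = 0")
  case True
  then have "f x = f 0 + 0 \<bullet> x" for x using constant_if_pointed[of x 0] by auto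
  then show ?thesis by blast
next
  case False
  then obtain v m where vm: "(v, m) \<in> Q" "(- v, - m) \<in> Q" "(v, m) \<noteq> 0" by auto
  have "v \<noteq> 0"
    using vm rec_cone_vertical[of m f] rec_cone_vertical[of "- m" f] by (auto simp: zero_prod_def)
  let ?r = "1 / norm v"
  have "(?r *\<^sub>R v, ?r * m) \<in> Q" "(- (?r *\<^sub>R v), - (?r * m)) \<in> Q"
    using rec_cone_scaleR[OF vm(1), of ?r] rec_cone_scaleR[OF vm(2), of ?r] by simp_all
  moreover have "norm (?r *\<^sub>R v) = 1" using \<open>v \<noteq> 0\<close> by simp
  ultimately show ?thesis by (intro affine_if_unit_line) auto
qed

lemma rigid_imp_affine:
  fixes f :: "real^2 \<Rightarrow> real"
  assumes cont: "continuous_on UNIV f" and rigid: "horizontally_rigid f"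
  shows "\<exists>a w. \<forall>x. f x = a + w \<bullet> x"
proof -
  define frame where "frame c P \<longleftrightarrow> orthogonal_transformation P \<and>
      (\<forall>v z. P (v, z) \<in> rec_cone f \<longleftrightarrow> (c *\<^sub>R v, z) \<in> rec_cone f) \<and>
      (\<exists>e b. \<bar>e\<bar> = (1::real) \<and> range (\<lambda>x. e *\<^sub>R P (x, f (c *\<^sub>R x)) + b) = fun_graph f)" for c P
  have "\<exists>P. frame c P" if c: "c > 0" for c
  proof -
    obtain \<phi> :: "(real^2) \<times> real \<Rightarrow> (real^2) \<times> real"
      where \<phi>: "isometry \<phi>" and img: "\<phi> ` fun_graph f = fun_graph (\<lambda>x. f (c *\<^sub>R x))"
      using rigid c unfolding horizontally_rigid_def by blast
    have bij: "bij \<phi>"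
      using \<phi> unfolding isometry_def bij_def inj_def by (metis dist_eq_0_iff)
    \<comment> \<open>The inverse is used so that the isometries for all scales end in the same
      graph, that of \<open>f\<close>.\<close>
    have "dist (inv \<phi> p) (inv \<phi> q) = dist p q" for p q
      using \<phi> surj_f_inv_f[OF bij_is_surj[OF bij]] unfolding isometry_def by metis
    then have inv: "isometry (inv \<phi>)"
      using bij_is_surj[OF bij_imp_bij_inv[OF bij]] by (simp add: isometry_def)
    have img': "inv \<phi> ` fun_graph (\<lambda>x. f (c *\<^sub>R x)) = fun_graph f"
      unfolding img[symmetric] by (simp add: image_inv_f_f bij_is_inj[OF bij])
    have cont': "continuous_on UNIV (\<lambda>x. f (c *\<^sub>R x))"
      by (intro continuous_on_compose2[OF cont] continuous_intros) auto
    obtain P e b where P: "orthogonal_transformation P" "\<bar>e\<bar> = (1::real)"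
      "\<And>w. P w \<in> rec_cone f \<longleftrightarrow> w \<in> rec_cone (\<lambda>x. f (c *\<^sub>R x))"
      "(\<lambda>p. e *\<^sub>R P p + b) ` fun_graph (\<lambda>x. f (c *\<^sub>R x)) = fun_graph f"
      using graph_isometry_rec_cone[OF cont cont' inv img'] by blast
    have "fun_graph (\<lambda>x. f (c *\<^sub>R x)) = range (\<lambda>x. (x, f (c *\<^sub>R x)))"
      by (auto simp: fun_graph_def)
    then have "range (\<lambda>x. e *\<^sub>R P (x, f (c *\<^sub>R x)) + b) = fun_graph f"
      using P(4) by (simp add: image_image)
    then show ?thesis using P(1-3) rec_cone_dilate[OF c, of _ _ f] unfolding frame_def by blast
  qed
  then obtain P where P: "\<And>c. c > 0 \<Longrightarrow> frame c (P c)" by metis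
  interpret rigid_frame f P
  proof
    show "continuous_on UNIV f" by fact
    show "orthogonal_transformation (P c)" if "c > 0" for c
      using P[OF that] by (simp add: frame_def)
    show "P c (v, z) \<in> rec_cone f \<longleftrightarrow> (c *\<^sub>R v, z) \<in> rec_cone f" if "c > 0" for c v z
      using P[OF that] by (simp add: frame_def)
    show "\<exists>e b. \<bar>e\<bar> = (1::real) \<and> range (\<lambda>x. e *\<^sub>R P c (x, f (c *\<^sub>R x)) + b) = fun_graph f" if "c > 0" for c
      using P[OF that] unfolding frame_def by blast
  qed
  show ?thesis by (rule affine)
qed

section \<open>Affine functions are horizontally rigid\<close>

lemma reflection_exists:
  fixes a b :: "'a::real_inner"
  assumes "norm a = norm b"
  shows "\<exists>R. orthogonal_transformation R \<and> R a = b \<and> (\<forall>x. R (R x) = x)"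
proof (cases "a = b")
  case True
  then show ?thesis by (intro exI[of _ "\<lambda>x. x"]) (simp add: orthogonal_transformation_id)
next
  case False
  \<comment> \<open>The reflection in the hyperplane orthogonal to \<open>a - b\<close> exchanges
    \<open>a\<close> and \<open>b\<close> because their norms agree.\<close>
  define u where "u = a - b"
  have uu: "u \<bullet> u \<noteq> 0" using False by (simp add: u_def)
  have ab: "a \<bullet> a = b \<bullet> b" using assms by (simp add: norm_eq)
  define k where "k = 2 / (u \<bullet> u)"
  have ku: "k * (u \<bullet> u) = 2" using uu by (simp add: k_def)
  define R where "R x = x - (k * (x \<bullet> u)) *\<^sub>R u" for x
  have cancel: "A - 2 * k * B * C + k * B * C * 2 = A" for A B C :: real by simp
  have "linear R"
    by (rule linearI) (simp_all add: R_def inner_left_distrib algebra_simps)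
  moreover have "R x \<bullet> R y = x \<bullet> y" for x y
  proof -
    have "R x \<bullet> R y = x \<bullet> y - 2 * k * (x \<bullet> u) * (y \<bullet> u) + k * (x \<bullet> u) * (y \<bullet> u) * (k * (u \<bullet> u))"
      by (simp add: R_def inner_diff_left inner_diff_right inner_commute[of u x] inner_commute[of u y] algebra_simps)
    also have "\<dots> = x \<bullet> y" unfolding ku by (rule cancel)
    finally show ?thesis .
  qed
  moreover have "R a = b"
  proof -
    have au: "u \<bullet> u = 2 * (a \<bullet> u)"
      using ab inner_commute[of b a] by (simp add: u_def inner_diff_left inner_diff_right)
    have "k * (a \<bullet> u) = 1" using ku unfolding au by simp
    then show ?thesis by (simp add: R_def u_def)
  qed
  moreover have "R (R x) = x" for x
  proof -
    have "R x \<bullet> u = x \<bullet> u - (k * (u \<bullet> u)) * (x \<bullet> u)"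
      by (simp add: R_def inner_diff_left algebra_simps)
    then have "R x \<bullet> u = - (x \<bullet> u)" unfolding ku by simp
    then show ?thesis unfolding R_def[of "R x"] by (simp add: R_def[of x])
  qed
  ultimately show ?thesis unfolding orthogonal_transformation_def by blast
qed

text \<open>Both graphs are hyperplanes through \<open>(0, a)\<close>, so a reflection exchanging
  their unit normals, conjugated by a translation to fix that point, maps one onto the
  other.\<close>

lemma affine_imp_rigid:
  fixes f :: "real^'n \<Rightarrow> real"
  assumes f: "\<And>x. f x = a + w \<bullet> x"
  shows "horizontally_rigid f"
  unfolding horizontally_rigid_def
proof (intro allI impI)
  fix c :: real assume "c > 0"
  \<comment> \<open>This factor normalises the normal vector \<open>(- t *\<^sub>R w, 1)\<close> of
    the graph at scale \<open>t\<close>.\<close>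
  define s where "s t = 1 / sqrt (1 + t\<^sup>2 * (w \<bullet> w))" for t
  define n where "n t = s t *\<^sub>R (- t *\<^sub>R w, 1::real)" for t
  have "1 + t\<^sup>2 * (w \<bullet> w) > 0" for t by (simp add: add_pos_nonneg)
  then have s: "(s t)\<^sup>2 * (1 + t\<^sup>2 * (w \<bullet> w)) = 1" "s t \<noteq> 0" for t
    by (simp_all add: s_def power_divide less_imp_le) (metis less_irrefl)+
  have "n t \<bullet> n t = 1" for t
  proof -
    have "n t \<bullet> n t = (s t)\<^sup>2 * (1 + t\<^sup>2 * (w \<bullet> w))"
      by (simp add: n_def power2_eq_square algebra_simps)
    then show ?thesis using s(1) by simp
  qed
  then have "norm (n 1) = norm (n c)" by (simp add: norm_eq)
  then obtain R where R: "orthogonal_transformation R" "R (n 1) = n c" "\<And>p. R (R p) = p"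
    using reflection_exists by blast
  have graph: "fun_graph (\<lambda>x. f (t *\<^sub>R x)) = {p. n t \<bullet> (p - (0, a)) = 0}" for t
  proof -
    have "n t \<bullet> (p - (0, a)) = 0 \<longleftrightarrow> snd p = f (t *\<^sub>R fst p)" for p
    proof -
      obtain x z where p: "p = (x, z)" by (cases p)
      have "n t \<bullet> (p - (0, a)) = s t * (z - a - t * (w \<bullet> x))"
        by (simp add: n_def p algebra_simps)
      then show ?thesis using s(2)[of t] by (auto simp: p f)
    qed
    then show ?thesis by (auto simp: fun_graph_def)
  qed
  define \<phi> where "\<phi> p = R (p - (0, a)) + (0, a)" for p
  have inv: "\<phi> (\<phi> p) = p" for p by (simp add: \<phi>_def R)
  have "dist (\<phi> p) (\<phi> q) = dist p q" for p q
  proof -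
    have "dist (R x) (R y) = dist x y" for x y
      using R(1) unfolding orthogonal_transformation_isometry by blast
    from this[of "p - (0, a)" "q - (0, a)"] show ?thesis by (simp add: \<phi>_def dist_norm)
  qed
  then have iso: "isometry \<phi>" using inv unfolding isometry_def by (metis surjI)
  have "n c \<bullet> (\<phi> p - (0, a)) = n 1 \<bullet> (p - (0, a))" for p
  proof -
    have "R (n 1) \<bullet> R (p - (0, a)) = n 1 \<bullet> (p - (0, a))"
      using R(1) unfolding orthogonal_transformation_def by blast
    then show ?thesis by (simp add: R(2) \<phi>_def)
  qed
  then have mem: "\<phi> p \<in> fun_graph (\<lambda>x. f (c *\<^sub>R x)) \<longleftrightarrow> p \<in> fun_graph f" for p
    using graph[of c] graph[of 1] by simp
  have img: "\<phi> ` fun_graph f = fun_graph (\<lambda>x. f (c *\<^sub>R x))"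
  proof (intro equalityI subsetI)
    fix p assume "p \<in> fun_graph (\<lambda>x. f (c *\<^sub>R x))"
    then have "\<phi> p \<in> fun_graph f" using mem[of "\<phi> p"] by (simp add: inv)
    then show "p \<in> \<phi> ` fun_graph f" using inv[of p] by (metis imageI)
  qed (use mem in auto)
  show "\<exists>\<phi>. isometry \<phi> \<and> \<phi> ` fun_graph f = fun_graph (\<lambda>x. f (c *\<^sub>R x))"
    using iso img by blast
qed

theorem theorem1p6:
  fixes f :: "real^2 \<Rightarrow> real"
  assumes "continuous_on UNIV f"
  shows "horizontally_rigid f \<longleftrightarrow>
    (\<exists>a b d :: real. \<forall>v. f v = a + b * v $ 1 + d * v $ 2)"
proof
  assume "horizontally_rigid f"
  then obtain a w where "\<And>v. f v = a + w \<bullet> v" using rigid_imp_affine[OF assms] by blast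
  then have "f v = a + w $ 1 * v $ 1 + w $ 2 * v $ 2" for v by (simp add: inner_vec_def sum_2)
  then show "\<exists>a b d :: real. \<forall>v. f v = a + b * v $ 1 + d * v $ 2" by blast
next
  assume "\<exists>a b d :: real. \<forall>v. f v = a + b * v $ 1 + d * v $ 2"
  then obtain a b d where "\<And>v. f v = a + b * v $ 1 + d * v $ 2" by blast
  then have "f v = a + vector [b, d] \<bullet> v" for v by (simp add: inner_vec_def sum_2)
  then show "horizontally_rigid f" by (rule affine_imp_rigid)
qed

end
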